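(* Let $$K=\left\{f\in W_2^1(\mathbb{R})\;\Big|\;\int_{\mathbb{R}}f^2(u)(1+|u|)^3du+\int_{\mathbb{R}}\left(f'(u)\right)^2(1+|u|)^7du\le1\right\},$$ regarded as a subset of $L_2(\mathbb{R})$. There exist positive constants $C_1,C_2$ such that for any $n\in\mathbb{N}$ $$\frac{C_1}{n}\le d_n(K)\le\frac{C_2}{n^{\frac{3}{10}}},$$ where $d_n(K)$ is the Kolmogorov $n$-width of $K$ in $L_2(\mathbb{R})$.
   Context: $W_2^1(\mathbb{R})$ is the Sobolev space of real functions in $L_2(\mathbb{R})$ with weak derivative in $L_2(\mathbb{R})$. The Kolmogorov $n$-width of a set $C\subseteq H$ in a Hilbert space $H$ is $$d_n(C)=\inf_{\dim L\le n}\,\sup_{f\in C}\,\inf_{g\in L}\|f-g\|_H,$$ where the first infimum is over linear subspaces $L$ of $H$ of dimension at most $n$. Here $\mathbb{N}=\{1,2,\dots\}$. *)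

theory Defs
  imports "HOL-Analysis.Analysis"
begin

section \<open>The Hilbert space of square-integrable real functions on the line\<close>

text \<open>
  Elements are classes modulo equality almost everywhere. Working with Borel representatives
  (\<open>lborel\<close>) loses nothing: every Lebesgue measurable function agrees almost everywhere with a
  Borel one.
\<close>

definition sq_integrable :: "(real \<Rightarrow> real) \<Rightarrow> bool" where
  "sq_integrable f \<longleftrightarrow>
     f \<in> borel_measurable lborel \<and> integrable lborel (\<lambda>x. (f x)\<^sup>2)"

lemma sq_integrable_measurable [simp]:
  "sq_integrable f \<Longrightarrow> f \<in> borel_measurable borel"
  by (simp add: sq_integrable_def)

lemma sq_integrable_zero: "sq_integrable (\<lambda>x. 0)"
  by (simp add: sq_integrable_def)

lemma sq_integrable_mult:
  assumes "sq_integrable f" "sq_integrable g"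
  shows "integrable lborel (\<lambda>x. f x * g x)"
proof (rule Bochner_Integration.integrable_bound)
  show "integrable lborel (\<lambda>x. (f x)\<^sup>2 + (g x)\<^sup>2)"
    using assms by (auto simp: sq_integrable_def)
  show "(\<lambda>x. f x * g x) \<in> borel_measurable lborel"
    using assms by (auto simp: sq_integrable_def)
  show "AE x in lborel. norm (f x * g x) \<le> norm ((f x)\<^sup>2 + (g x)\<^sup>2)"
  proof (rule AE_I2)
    fix x
    have "2 * (\<bar>f x\<bar> * \<bar>g x\<bar>) \<le> (f x)\<^sup>2 + (g x)\<^sup>2"
      using sum_squares_bound[of "\<bar>f x\<bar>" "\<bar>g x\<bar>"] by simp
    moreover have "0 \<le> \<bar>f x\<bar> * \<bar>g x\<bar>" by simp
    ultimately show "norm (f x * g x) \<le> norm ((f x)\<^sup>2 + (g x)\<^sup>2)"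
      unfolding real_norm_def abs_mult by linarith
  qed
qed

lemma sq_integrable_add:
  assumes "sq_integrable f" "sq_integrable g"
  shows "sq_integrable (\<lambda>x. f x + g x)"
proof -
  have "integrable lborel (\<lambda>x. (f x)\<^sup>2 + (g x)\<^sup>2 + 2 * (f x * g x))"
    using assms sq_integrable_mult[OF assms] by (auto simp: sq_integrable_def)
  then have "integrable lborel (\<lambda>x. (f x + g x)\<^sup>2)"
    by (simp add: power2_sum mult.assoc)
  then show ?thesis using assms by (auto simp: sq_integrable_def)
qed

lemma sq_integrable_scale:
  "sq_integrable f \<Longrightarrow> sq_integrable (\<lambda>x. r * f x)"
  by (auto simp: sq_integrable_def power_mult_distrib)

definition L2_rel :: "(real \<Rightarrow> real) \<Rightarrow> (real \<Rightarrow> real) \<Rightarrow> bool" where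
  "L2_rel f g \<longleftrightarrow>
     sq_integrable f \<and> sq_integrable g \<and> (AE x in lborel. f x = g x)"

lemma part_equivp_L2_rel: "part_equivp L2_rel"
proof (rule part_equivpI)
  show "\<exists>f. L2_rel f f"
    using sq_integrable_zero by (auto simp: L2_rel_def)
  show "symp L2_rel"
    by (auto intro!: sympI simp: L2_rel_def elim: eventually_mono)
  show "transp L2_rel"
    by (auto intro!: transpI simp: L2_rel_def elim: eventually_elim2)
qed

quotient_type L2 = "real \<Rightarrow> real" / partial: L2_rel
  by (rule part_equivp_L2_rel)

instantiation L2 :: real_inner
begin

lift_definition zero_L2 :: L2 is "\<lambda>x. 0"
  by (simp add: L2_rel_def sq_integrable_zero)

lift_definition plus_L2 :: "L2 \<Rightarrow> L2 \<Rightarrow> L2" is "\<lambda>f g x. f x + g x"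
  by (auto simp: L2_rel_def sq_integrable_add elim: eventually_elim2)

lift_definition scaleR_L2 :: "real \<Rightarrow> L2 \<Rightarrow> L2" is "\<lambda>r f x. r * f x"
  by (auto simp: L2_rel_def sq_integrable_scale elim: eventually_mono)

lift_definition uminus_L2 :: "L2 \<Rightarrow> L2" is "\<lambda>f x. - f x"
  using sq_integrable_scale[of _ "-1"]
  by (auto simp: L2_rel_def elim: eventually_mono)

definition minus_L2 :: "L2 \<Rightarrow> L2 \<Rightarrow> L2" where
  "minus_L2 f g = f + (- g)"

lift_definition inner_L2 :: "L2 \<Rightarrow> L2 \<Rightarrow> real" is "\<lambda>f g. LINT x|lborel. f x * g x"
  by (rule integral_cong_AE)
    (auto intro!: borel_measurable_times simp: L2_rel_def elim: eventually_elim2)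

definition norm_L2 :: "L2 \<Rightarrow> real" where
  "norm_L2 f = sqrt (inner f f)"

definition dist_L2 :: "L2 \<Rightarrow> L2 \<Rightarrow> real" where
  "dist_L2 f g = norm (f - g)"

definition sgn_L2 :: "L2 \<Rightarrow> L2" where
  "sgn_L2 f = inverse (norm f) *\<^sub>R f"

definition uniformity_L2 :: "(L2 \<times> L2) filter" where
  "uniformity_L2 = (INF e\<in>{0<..}. principal {(f, g). dist f g < e})"

definition open_L2 :: "L2 set \<Rightarrow> bool" where
  "open_L2 U \<longleftrightarrow> (\<forall>f\<in>U. eventually (\<lambda>(f', g). f' = f \<longrightarrow> g \<in> U) uniformity)"

instance
proof
  fix f g h :: L2 and r s :: real and U :: "L2 set"
  show "f + g + h = f + (g + h)"
    by transfer (auto simp: L2_rel_def sq_integrable_add add.assoc elim: eventually_elim2)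
  show "f + g = g + f"
    by transfer (auto simp: L2_rel_def sq_integrable_add add.commute)
  show "0 + f = f"
    by transfer (auto simp: L2_rel_def)
  show "- f + f = 0"
    by transfer (auto simp: L2_rel_def sq_integrable_zero)
  show "f - g = f + - g"
    by (rule minus_L2_def)
  show "r *\<^sub>R (f + g) = r *\<^sub>R f + r *\<^sub>R g"
    by transfer (auto simp: L2_rel_def sq_integrable_add sq_integrable_scale distrib_left)
  show "(r + s) *\<^sub>R f = r *\<^sub>R f + s *\<^sub>R f"
    by transfer (auto simp: L2_rel_def sq_integrable_add sq_integrable_scale distrib_right)
  show "r *\<^sub>R s *\<^sub>R f = (r * s) *\<^sub>R f"
    by transfer (auto simp: L2_rel_def sq_integrable_scale mult.assoc)
  show "1 *\<^sub>R f = f"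
    by transfer (auto simp: L2_rel_def)
  show "sgn f = inverse (norm f) *\<^sub>R f"
    by (rule sgn_L2_def)
  show "dist f g = norm (f - g)"
    by (rule dist_L2_def)
  show "uniformity = (INF e\<in>{0<..}. principal {(f :: L2, g). dist f g < e})"
    by (rule uniformity_L2_def)
  show "open U \<longleftrightarrow> (\<forall>f\<in>U. \<forall>\<^sub>F (f', g) in uniformity. f' = f \<longrightarrow> g \<in> U)"
    by (rule open_L2_def)
  show "inner f g = inner g f"
    by transfer (simp add: mult.commute)
  show "inner (f + g) h = inner f h + inner g h"
    by transfer (auto simp: L2_rel_def distrib_right sq_integrable_mult)
  show "inner (r *\<^sub>R f) g = r * inner f g"
    by transfer (simp add: mult.assoc)
  show "0 \<le> inner f f"
    by transfer simp
  show "inner f f = 0 \<longleftrightarrow> f = 0"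
  proof transfer
    fix f assume "L2_rel f f"
    then have f: "sq_integrable f" by (simp add: L2_rel_def)
    then have "(LINT x|lborel. f x * f x) = 0 \<longleftrightarrow> (AE x in lborel. f x * f x = 0)"
      by (intro integral_nonneg_eq_0_iff_AE) (auto intro: sq_integrable_mult)
    then show "(LINT x|lborel. f x * f x) = 0 \<longleftrightarrow> L2_rel f (\<lambda>x. 0)"
      using f by (simp add: L2_rel_def sq_integrable_zero)
  qed
  show "norm f = sqrt (inner f f)"
    by (rule norm_L2_def)
qed

end


section \<open>Weak derivatives and weighted norms\<close>

definition test_function :: "(real \<Rightarrow> real) \<Rightarrow> bool" where
  "test_function \<phi> \<longleftrightarrow>
     (\<forall>k. ((deriv ^^ k) \<phi>) differentiable_on UNIV) \<and> compact (closure {x. \<phi> x \<noteq> 0})"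

lemma test_function_deriv_measurable:
  assumes "test_function \<phi>"
  shows "\<phi> \<in> borel_measurable lborel" "deriv \<phi> \<in> borel_measurable lborel"
proof -
  have "((deriv ^^ k) \<phi>) \<in> borel_measurable borel" for k
    using assms by (intro borel_measurable_continuous_onI differentiable_imp_continuous_on)
      (auto simp: test_function_def)
  from this[of 0] this[of 1] show "\<phi> \<in> borel_measurable lborel" "deriv \<phi> \<in> borel_measurable lborel"
    by simp_all
qed

lift_definition has_weak_deriv :: "L2 \<Rightarrow> L2 \<Rightarrow> bool" is
  "\<lambda>f f'. \<forall>\<phi>. test_function \<phi> \<longrightarrow>
     (LINT x|lborel. f x * deriv \<phi> x) = - (LINT x|lborel. f' x * \<phi> x)"
proof -
  fix f g f' g' assume fg: "L2_rel f g" and fg': "L2_rel f' g'"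
  have "(LINT x|lborel. f x * deriv \<phi> x) = (LINT x|lborel. g x * deriv \<phi> x)"
    "(LINT x|lborel. f' x * \<phi> x) = (LINT x|lborel. g' x * \<phi> x)" if "test_function \<phi>" for \<phi>
    using fg fg' test_function_deriv_measurable[OF that]
    by (auto intro!: integral_cong_AE borel_measurable_times simp: L2_rel_def elim: eventually_mono)
  then show "(\<forall>\<phi>. test_function \<phi> \<longrightarrow>
        (LINT x|lborel. f x * deriv \<phi> x) = - (LINT x|lborel. f' x * \<phi> x)) =
      (\<forall>\<phi>. test_function \<phi> \<longrightarrow>
        (LINT x|lborel. g x * deriv \<phi> x) = - (LINT x|lborel. g' x * \<phi> x))"
    by auto
qed

definition W21 :: "L2 set" where
  "W21 = {f. \<exists>f'. has_weak_deriv f f'}"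

text \<open>The integral takes its value in \<open>[0, \<infinity>]\<close>, so it needs no integrability condition.\<close>

lift_definition weighted_sq_integral :: "(real \<Rightarrow> real) \<Rightarrow> L2 \<Rightarrow> ennreal" is
  "\<lambda>w f. \<integral>\<^sup>+u. ennreal ((f u)\<^sup>2 * w u) \<partial>lborel"
  by (rule nn_integral_cong_AE) (auto simp: L2_rel_def elim: eventually_mono)

text \<open>The weak derivative is unique in \<open>L2\<close>, so the quantifier only names it.\<close>

definition K :: "L2 set" where
  "K = {f \<in> W21. \<exists>f'. has_weak_deriv f f' \<and>
          weighted_sq_integral (\<lambda>u. (1 + \<bar>u\<bar>) ^ 3) f
            + weighted_sq_integral (\<lambda>u. (1 + \<bar>u\<bar>) ^ 7) f' \<le> 1}"


section \<open>Kolmogorov widths\<close>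

text \<open>
  \<open>dim\<close> is \<open>0\<close> on infinite-dimensional subspaces, hence the explicit finite spanning set. The
  values are extended nonnegative reals, so that all suprema and infima are the true ones.
\<close>

definition kolmogorov_width :: "nat \<Rightarrow> 'a::real_inner set \<Rightarrow> ennreal" where
  "kolmogorov_width n C =
     (INF L\<in>{L. subspace L \<and> (\<exists>B. finite B \<and> span B = L) \<and> dim L \<le> n}.
        SUP f\<in>C. INF g\<in>L. ennreal (norm (f - g)))"

end

theory Submission
  imports Defs
begin

text \<open>
  Lower bound: \<open>n + 1\<close> parabolic bumps on disjoint intervals of length \<open>h = 1 / (n + 1)\<close> in \<open>[0, 1]\<close>
  span a space on which \<open>\<parallel>f'\<parallel>\<^sup>2 = 10 / h\<^sup>2 * \<parallel>f\<parallel>\<^sup>2\<close>, so its sphere of radius \<open>1 / (80 n)\<close> lies in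
  \<open>K\<close>. Every subspace of dimension at most \<open>n\<close> has a point of this sphere in its orthogonal
  complement.

  Upper bound: with \<open>R = n powr (1 / 5)\<close>, approximate \<open>f\<close> by \<open>0\<close> outside \<open>(-R, R]\<close> and by a step
  function on \<open>n\<close> cells of length \<open>h = 2 R / n\<close> inside. The weights give a squared error of at most
  \<open>1 / (1 + R) ^ 3\<close> outside, and the Cauchy--Schwarz inequality one of at most \<open>h\<^sup>2\<close> inside. The latter
  needs a representative of \<open>f\<close> that is a primitive of \<open>f'\<close>, which is du Bois-Reymond's lemma; its test
  functions are built from \<open>exp (- 1 / x)\<close>.
\<close>

section \<open>Smooth functions\<close>

text \<open>This is the differentiability half of \<open>test_function\<close>; without compact
  support, ramps and primitives qualify too.\<close>

definition smooth :: "(real \<Rightarrow> real) \<Rightarrow> bool" where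
  "smooth f \<longleftrightarrow> (\<forall>k. (deriv ^^ k) f differentiable_on UNIV)"

text \<open>By induction every iterated derivative stays in \<open>S\<close>, since the derivative
  found in \<open>S\<close> must be \<open>deriv\<close>. Smoothness thus reduces to exhibiting a
  family closed under differentiation.\<close>

lemma smooth_coinduct:
  assumes "f \<in> S" and "\<And>g. g \<in> S \<Longrightarrow> \<exists>g'\<in>S. \<forall>x. DERIV g x :> g' x"
  shows "smooth f"
proof -
  have "(deriv ^^ k) f \<in> S" for k
  proof (induction k)
    case (Suc k)
    then obtain g' where g': "g' \<in> S" "\<forall>x. DERIV ((deriv ^^ k) f) x :> g' x"
      using assms(2) by blast
    then have "deriv ((deriv ^^ k) f) = g'"
      by (auto intro!: ext DERIV_imp_deriv)
    with g' show ?case by simp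
  qed (simp add: assms(1))
  then show ?thesis
    using assms(2) unfolding smooth_def differentiable_on_def
    by (metis UNIV_I real_differentiable_def)
qed

lemma smooth_DERIV: "smooth f \<Longrightarrow> DERIV f x :> deriv f x"
  unfolding smooth_def
  by (drule spec[of _ 0]) (simp add: differentiable_on_def DERIV_deriv_iff_real_differentiable)

lemma smooth_deriv: "smooth f \<Longrightarrow> smooth (deriv f)"
  unfolding smooth_def by (rule allI, drule_tac x = "Suc k" in spec) (simp only: funpow_Suc_right comp_apply)

lemma smooth_continuous: "smooth f \<Longrightarrow> continuous_on A f"
  by (intro continuous_at_imp_continuous_on ballI DERIV_isCont[OF smooth_DERIV])

lemma smooth_primitive:
  assumes "\<And>x. DERIV F x :> f x" "smooth f"
  shows "smooth F"
proof (rule smooth_coinduct[where S = "insert F (Collect smooth)"])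
  fix g assume "g \<in> insert F (Collect smooth)"
  then consider "g = F" | "smooth g" by blast
  then show "\<exists>g'\<in>insert F (Collect smooth). \<forall>x. DERIV g x :> g' x"
  proof cases
    case 1
    then show ?thesis using assms by (intro bexI[of _ f]) simp_all
  next
    case 2
    then show ?thesis
      by (intro bexI[of _ "deriv g"]) (simp_all add: smooth_DERIV smooth_deriv)
  qed
qed simp

lemma smooth_add:
  assumes "smooth f" "smooth g"
  shows "smooth (\<lambda>x. f x + g x)"
proof (rule smooth_coinduct[where S = "{\<lambda>x. f x + g x |f g. smooth f \<and> smooth g}"])
  fix u assume "u \<in> {\<lambda>x. f x + g x |f g. smooth f \<and> smooth g}"
  then obtain f g where u: "u = (\<lambda>x. f x + g x)" "smooth f" "smooth g" by blast
  then have "\<forall>x. DERIV u x :> deriv f x + deriv g x"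
    by (auto intro!: DERIV_add smooth_DERIV)
  with u show "\<exists>g'\<in>{\<lambda>x. f x + g x |f g. smooth f \<and> smooth g}. \<forall>x. DERIV u x :> g' x"
    by (intro bexI[of _ "\<lambda>x. deriv f x + deriv g x"]) (auto intro: smooth_deriv)
qed (use assms in blast)

text \<open>The chain rule adds a factor \<open>a\<close> at each differentiation; the family lets
  \<open>c\<close> vary in order to absorb it.\<close>

lemma smooth_affine:
  assumes "smooth f"
  shows "smooth (\<lambda>x. c * f (a * x + b))"
proof (rule smooth_coinduct[where S = "{\<lambda>x. c * f (a * x + b) |f c. smooth f}"])
  fix u assume "u \<in> {\<lambda>x. c * f (a * x + b) |f c. smooth f}"
  then obtain f c where u: "u = (\<lambda>x. c * f (a * x + b))" "smooth f" by blast
  then have "\<forall>x. DERIV u x :> (c * a) * deriv f (a * x + b)"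
    by (auto intro!: derivative_eq_intros DERIV_chain2[OF smooth_DERIV])
  with u show "\<exists>g'\<in>{\<lambda>x. c * f (a * x + b) |f c. smooth f}. \<forall>x. DERIV u x :> g' x"
    by (intro bexI[of _ "\<lambda>x. (c * a) * deriv f (a * x + b)"]) (auto intro: smooth_deriv)
qed (use assms in blast)

lemma smooth_mult:
  assumes "smooth f" "smooth g"
  shows "smooth (\<lambda>x. f x * g x)"
proof -
  \<comment> \<open>Finite sums of products of smooth functions are closed under differentiation.\<close>
  define S where "S = {u. \<exists>I :: nat set. \<exists>f g. finite I \<and> (\<forall>i. smooth (f i) \<and> smooth (g i)) \<and>
    u = (\<lambda>x. \<Sum>i\<in>I. f i x * g i x)}"
  show ?thesis
  proof (rule smooth_coinduct[where S = S])
    show "(\<lambda>x. f x * g x) \<in> S"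
      unfolding S_def using assms
      by (intro CollectI exI[of _ "{0}"] exI[of _ "\<lambda>_. f"] exI[of _ "\<lambda>_. g"]) auto
  next
    fix u assume "u \<in> S"
    then obtain I :: "nat set" and f g where I: "finite I"
      and fg: "\<And>i. smooth (f i)" "\<And>i. smooth (g i)" and u: "u = (\<lambda>x. \<Sum>i\<in>I. f i x * g i x)"
      unfolding S_def by (elim CollectE exE conjE) (rule that; simp)
    define u' where "u' x = (\<Sum>i\<in>I. deriv (f i) x * g i x + deriv (g i) x * f i x)" for x
    have "DERIV u x :> u' x" for x
      unfolding u u'_def by (intro DERIV_sum DERIV_mult smooth_DERIV fg)
    moreover have "u' \<in> S"
    proof -
      \<comment> \<open>The Leibniz rule doubles the number of terms: index \<open>2 * i\<close>
        carries \<open>deriv (f i)\<close> times \<open>g i\<close>, and index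
        \<open>2 * i + 1\<close> carries \<open>deriv (g i)\<close> times
        \<open>f i\<close>.\<close>
      define F where "F i = (if even i then deriv (f (i div 2)) else deriv (g (i div 2)))" for i
      define G where "G i = (if even i then g (i div 2) else f (i div 2))" for i
      define J where "J = (*) 2 ` I \<union> (\<lambda>i. 2 * i + 1) ` I"
      have "(\<Sum>i\<in>J. F i x * G i x) = u' x" for x
      proof -
        have "(\<Sum>i\<in>J. F i x * G i x) =
            (\<Sum>i\<in>(*) 2 ` I. F i x * G i x) + (\<Sum>i\<in>(\<lambda>i. 2 * i + 1) ` I. F i x * G i x)"
          unfolding J_def using I by (intro sum.union_disjoint) (auto, presburger)
        also have "\<dots> = u' x"
          by (subst (1 2) sum.reindex)
            (auto simp: inj_on_def F_def G_def u'_def sum.distrib)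
        finally show ?thesis .
      qed
      moreover have "finite J" "\<And>i. smooth (F i)" "\<And>i. smooth (G i)"
        using I fg by (auto simp: J_def F_def G_def smooth_deriv)
      ultimately show ?thesis
        unfolding S_def by (intro CollectI exI[of _ J] exI[of _ F] exI[of _ G]) auto
    qed
    ultimately show "\<exists>g'\<in>S. \<forall>x. DERIV u x :> g' x" by blast
  qed
qed

text \<open>This family contains the standard flat function and is closed under differentiation.\<close>

definition flat_fun :: "real poly \<Rightarrow> real \<Rightarrow> real" where
  "flat_fun p x = (if x > 0 then exp (- inverse x) * poly p (inverse x) else 0)"

lemma poly_times_exp_tendsto_0: "((\<lambda>y. exp (- y) * poly p y) \<longlongrightarrow> (0::real)) at_top"
proof -
  have "((\<lambda>y. \<Sum>i\<le>degree p. coeff p i * (y ^ i / exp y)) \<longlongrightarrow> (\<Sum>i\<le>degree p. coeff p i * 0)) at_top"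
    by (intro tendsto_intros tendsto_power_div_exp_0)
  then show ?thesis
    by (simp add: poly_altdef exp_minus field_simps sum_distrib_left sum_divide_distrib)
qed

text \<open>For \<open>y = inverse x\<close>, differentiation in \<open>x\<close> is
  \<open>- y\<^sup>2\<close> times differentiation in \<open>y\<close>, and
  \<open>exp (- y) * p\<close> has \<open>y\<close>-derivative \<open>exp (- y) * (p' - p)\<close>.
  The factor \<open>[:0, 0, 1:]\<close> is \<open>y\<^sup>2\<close>.\<close>

lemma flat_fun_DERIV:
  "DERIV (flat_fun p) x :> flat_fun ([:0, 0, 1:] * (p - pderiv p)) x"
proof -
  consider "x < 0" | "x = 0" | "x > 0" by linarith
  then show ?thesis
  proof cases
    case 1
    have "DERIV (\<lambda>x. 0) x :> (0::real)" by simp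
    moreover have "\<forall>\<^sub>F y in nhds x. flat_fun p y = 0"
      using 1 by (intro eventually_mono[OF eventually_nhds_in_open[of "{..<0}"]]) (auto simp: flat_fun_def)
    ultimately have "DERIV (flat_fun p) x :> 0"
      by (subst DERIV_cong_ev[OF refl _ refl]) auto
    then show ?thesis using 1 by (simp add: flat_fun_def)
  next
    case 2
    have "((\<lambda>h. (flat_fun p (0 + h) - flat_fun p 0) / h) \<longlongrightarrow> 0) (at_right 0)"
    proof -
      \<comment> \<open>Dividing by \<open>h\<close> multiplies the polynomial by
        \<open>inverse h\<close>, hence \<open>pCons 0 p\<close>; exponential decay still
        wins.\<close>
      have "((\<lambda>h. exp (- inverse h) * poly (pCons 0 p) (inverse h)) \<longlongrightarrow> 0) (at_right (0::real))"
        using filterlim_compose[OF poly_times_exp_tendsto_0 filterlim_inverse_at_top_right] .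
      moreover have "\<forall>\<^sub>F h in at_right 0. exp (- inverse h) * poly (pCons 0 p) (inverse h) =
        (flat_fun p (0 + h) - flat_fun p 0) / h"
        by (intro eventually_at_rightI[of 0 1]) (auto simp: flat_fun_def field_simps)
      ultimately show ?thesis using tendsto_cong by fast
    qed
    moreover have "((\<lambda>h. (flat_fun p (0 + h) - flat_fun p 0) / h) \<longlongrightarrow> 0) (at_left 0)"
      by (intro tendsto_eventually eventually_at_leftI[of "-1"]) (auto simp: flat_fun_def)
    ultimately show ?thesis
      using 2 by (simp add: DERIV_def filterlim_at_split flat_fun_def)
  next
    case 3
    have "DERIV (\<lambda>x. exp (- inverse x) * poly p (inverse x)) x :>
        flat_fun ([:0, 0, 1:] * (p - pderiv p)) x"
      using 3 by (auto intro!: derivative_eq_intros DERIV_chain2[OF poly_DERIV]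
        simp: flat_fun_def field_simps power2_eq_square)
    moreover have "\<forall>\<^sub>F y in nhds x. flat_fun p y = exp (- inverse y) * poly p (inverse y)"
      using 3 by (intro eventually_mono[OF eventually_nhds_in_open[of "{0<..}"]]) (auto simp: flat_fun_def)
    ultimately show ?thesis
      by (subst DERIV_cong_ev[OF refl _ refl]) auto
  qed
qed

lemma smooth_flat_fun: "smooth (flat_fun p)"
proof (rule smooth_coinduct[where S = "range flat_fun"])
  fix g assume "g \<in> range flat_fun"
  then obtain q where "g = flat_fun q" by blast
  then show "\<exists>g'\<in>range flat_fun. \<forall>x. DERIV g x :> g' x"
    by (intro bexI[of _ "flat_fun ([:0, 0, 1:] * (q - pderiv q))"])
      (simp_all only: flat_fun_DERIV simp_thms rangeI)
qed simp

lemma primitive_of_right_supported: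
  fixes f :: "real \<Rightarrow> real"
  assumes "continuous_on UNIV f" and f0: "\<And>x. x \<le> 0 \<Longrightarrow> f x = 0"
  obtains F where "\<And>x. x \<le> 0 \<Longrightarrow> F x = 0" "\<And>x. DERIV F x :> f x"
proof
  \<comment> \<open>Starting at \<open>-1\<close> instead of \<open>0\<close> makes \<open>0\<close>
    an interior point of \<open>{-1..x+1}\<close>, so the two-sided derivative there needs no case
    of its own.\<close>
  define F where "F x = integral {-1..x} f" for x
  show F0: "F x = 0" if "x \<le> 0" for x
    unfolding F_def using that f0 by (intro integral_unique has_integral_is_0) auto
  show "DERIV F x :> f x" for x
  proof (cases "x < 0")
    case True
    have "DERIV (\<lambda>x. 0) x :> (0::real)" by simp
    moreover have "\<forall>\<^sub>F y in nhds x. F y = 0"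
      using True by (intro eventually_mono[OF eventually_nhds_in_open[of "{..<0}"]]) (auto simp: F0)
    ultimately have "DERIV F x :> 0"
      by (subst DERIV_cong_ev[OF refl _ refl]) auto
    then show ?thesis using True f0 by simp
  next
    case False
    then have "(F has_real_derivative f x) (at x within {-1..x+1})"
      unfolding F_def using assms(1)
      by (intro integral_has_real_derivative) (auto intro: continuous_on_subset)
    then show ?thesis
      using False by (simp add: at_within_Icc_at)
  qed
qed

text \<open>Two integrations: a bump \<open>b\<close> has a primitive \<open>B\<close> that is
  constant beyond \<open>1\<close>, normalising it gives a smooth step \<open>H\<close>, and
  \<open>G\<close> is a primitive of \<open>H\<close>. The ramp is kept because test functions will
  be combined from copies of \<open>G\<close>, so that their derivatives are combinations of
  steps.\<close>

lemma smooth_ramp_exists: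
  obtains G where "smooth G" "\<And>x. x \<le> 0 \<Longrightarrow> G x = 0" "\<And>x. 0 \<le> deriv G x" "\<And>x. deriv G x \<le> 1"
    "\<And>x. x \<le> 0 \<Longrightarrow> deriv G x = 0" "\<And>x. x \<ge> 1 \<Longrightarrow> deriv G x = 1"
proof -
  \<comment> \<open>The flat function times its reflection about \<open>1 / 2\<close> is positive
    exactly strictly between \<open>0\<close> and \<open>1\<close>. The form of the second factor
    matches \<open>smooth_affine\<close>.\<close>
  define b where "b x = flat_fun 1 x * (1 * flat_fun 1 ((-1) * x + 1))" for x
  have sb: "smooth b"
    unfolding b_def by (intro smooth_mult smooth_affine smooth_flat_fun)
  have b_nonneg: "b x \<ge> 0" for x by (simp add: b_def flat_fun_def)
  have b0: "b x = 0" if "x \<le> 0 \<or> x \<ge> 1" for x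
    using that by (auto simp: b_def flat_fun_def)
  obtain B where B0: "\<And>x. x \<le> 0 \<Longrightarrow> B x = 0" and B: "\<And>x. DERIV B x :> b x"
    using primitive_of_right_supported[of b] smooth_continuous[OF sb] b0 by blast
  have B_mono: "B x \<le> B y" if "x \<le> y" for x y
    using DERIV_nonneg_imp_nondecreasing[OF that] B b_nonneg by blast
  have "B 0 < B 1"
  proof (rule DERIV_pos_imp_increasing_open[where f = B])
    show "\<exists>y. DERIV B x :> y \<and> y > 0" if "0 < x" "x < 1" for x
      using that B[of x] by (intro exI[of _ "b x"]) (auto simp: b_def flat_fun_def)
    show "continuous_on {0..1} B"
      by (meson B DERIV_isCont continuous_at_imp_continuous_on)
  qed simp
  then have B1: "B 1 > 0" using B0[of 0] by simp
  have B_ge1: "B x = B 1" if "x \<ge> 1" for x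
  proof -
    have "DERIV B y :> 0" if "1 \<le> y" for y using B[of y] b0[of y] that by simp
    then have "\<exists>c. \<forall>y\<in>{1..}. B y = c"
      by (intro has_field_derivative_zero_constant) (auto intro: has_field_derivative_at_within)
    then show ?thesis using that by force
  qed
  define H where "H x = inverse (B 1) * B (1 * x + 0)" for x
  have sH: "smooth H"
    unfolding H_def by (intro smooth_affine smooth_primitive[OF B sb])
  have H0: "H x = 0" if "x \<le> 0" for x using that B0 by (simp add: H_def)
  obtain G where G0: "\<And>x. x \<le> 0 \<Longrightarrow> G x = 0" and G: "\<And>x. DERIV G x :> H x"
    using primitive_of_right_supported[of H] smooth_continuous[OF sH] H0 by blast
  have dG: "deriv G x = H x" for x using G by (rule DERIV_imp_deriv)
  show thesis
  proof (rule that)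
    show "smooth G" by (rule smooth_primitive[OF G sH])
    \<comment> \<open>\<open>B\<close> is \<open>0\<close> at \<open>min x 0\<close> and
      \<open>B 1\<close> at \<open>max x 1\<close>, so monotonicity gives both bounds on
      \<open>H\<close> without a case distinction.\<close>
    show "0 \<le> deriv G x" for x
      using B_mono[of "min x 0" x] B0[of "min x 0"] B1 by (simp add: dG H_def)
    show "deriv G x \<le> 1" for x
      using B_mono[of x "max x 1"] B_ge1[of "max x 1"] B1 by (simp add: dG H_def field_simps)
    show "deriv G x = 1" if "x \<ge> 1" for x
      using B_ge1[OF that] B1 by (simp add: dG H_def)
  qed (simp_all add: G0 H0 dG)
qed

section \<open>Weak derivatives and primitives\<close>

text \<open>The positive and the negative part of \<open>w\<close> are densities of measures that
  agree, with finite values, on all rays. Hence the measures are equal, and so are the two parts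
  almost everywhere; at most one of them is nonzero at a point.\<close>

lemma AE_eq_0_of_integral_greaterThan:
  fixes w :: "real \<Rightarrow> real"
  assumes w: "integrable lborel w"
    and 0: "\<And>a. (LINT y|lborel. indicat_real {a<..} y * w y) = 0"
  shows "AE x in lborel. w x = 0"
proof -
  have [measurable]: "w \<in> borel_measurable borel" using w by auto
  \<comment> \<open>Since \<open>ennreal\<close> sends negative numbers to \<open>0\<close>, the
    density of \<open>P 1\<close> is the positive part of \<open>w\<close> and that of
    \<open>P (-1)\<close> the negative part.\<close>
  define P where "P s = density lborel (\<lambda>x. ennreal (s * w x))" for s
  have em: "emeasure (P s) {a<..} = (\<integral>\<^sup>+x. ennreal (s * (indicat_real {a<..} x * w x)) \<partial>lborel)" for s a
    unfolding P_def by (subst emeasure_density) (auto intro!: nn_integral_cong split: split_indicator)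
  have ind: "integrable lborel (\<lambda>x. s * (indicat_real {a<..} x * w x))" for s a
    using w by (intro integrable_mult_right) (simp add: integrable_mult_indicator[where 'b = real, simplified])
  have fin: "emeasure (P s) {a<..} < \<infinity>" for s a
    using ind[of s a] unfolding em integrable_iff_bounded
    by (auto elim!: le_less_trans[rotated] intro!: nn_integral_mono ennreal_leI)
  have "P 1 = P (-1)"
  proof (rule measure_eqI_lessThan)
    fix a
    have "enn2real (emeasure (P 1) {a<..}) - enn2real (emeasure (P (-1)) {a<..}) = 0"
      using real_lebesgue_integral_def[OF ind[of 1 a]] 0[of a] by (simp add: em)
    then show "emeasure (P 1) {a<..} = emeasure (P (-1)) {a<..}"
      using fin[of 1 a] fin[of "-1" a]
      by (metis ennreal_enn2real eq_iff_diff_eq_0 infinity_ennreal_def)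
    show "emeasure (P 1) {a<..} < \<infinity>" for a by (rule fin)
  qed (simp_all add: P_def)
  then have "AE x in lborel. ennreal (1 * w x) = ennreal (-1 * w x)"
    unfolding P_def by (intro sigma_finite_measure.density_unique[OF sigma_finite_lborel]) auto
  then show ?thesis
  proof eventually_elim
    case (elim x)
    then show ?case
      by (cases "w x \<ge> 0") (auto simp: ennreal_neg ennreal_eq_0_iff dest: sym)
  qed
qed

text \<open>Fubini's theorem on the half plane \<open>y <= x\<close> replaces the product rule,
  because the primitive of a merely integrable \<open>g\<close> need not be differentiable
  everywhere. Integrating over \<open>x\<close> first leaves \<open>- \<phi> y\<close>.\<close>

lemma integral_primitive_by_parts:
  fixes g \<phi> :: "real \<Rightarrow> real"
  assumes g: "integrable lborel g"
    and d: "\<And>x. DERIV \<phi> x :> \<phi>' x" and c: "continuous_on UNIV \<phi>'"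
    and z: "\<And>x. \<bar>x\<bar> \<ge> A \<Longrightarrow> \<phi> x = 0" "\<And>x. \<bar>x\<bar> > A \<Longrightarrow> \<phi>' x = 0"
  shows "(LINT x|lborel. (LINT y|lborel. indicat_real {..x} y * g y) * \<phi>' x) = - (LINT y|lborel. g y * \<phi> y)"
proof -
  have [measurable]: "g \<in> borel_measurable borel" using g by auto
  have [measurable]: "\<phi>' \<in> borel_measurable borel" using c by (rule borel_measurable_continuous_onI)
  have \<phi>': "integrable lborel \<phi>'"
  proof -
    have "integrable lborel (\<lambda>x. indicator {-A..A} x *\<^sub>R \<phi>' x)"
      by (intro borel_integrable_compact continuous_on_subset[OF c]) auto
    then show ?thesis
      by (rule Bochner_Integration.integrable_cong[THEN iffD1, rotated -1])
        (use z(2) in \<open>auto split: split_indicator\<close>)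
  qed
  have prod: "integrable (lborel \<Otimes>\<^sub>M lborel) (\<lambda>(x, y). \<phi>' x * g y)"
  proof (rule lborel_pair.Fubini_integrable)
    show "integrable lborel (\<lambda>x. LINT y|lborel. norm (case (x, y) of (x, y) \<Rightarrow> \<phi>' x * g y))"
      using \<phi>' by (simp add: abs_mult)
  qed (use g in auto)
  have "integrable (lborel \<Otimes>\<^sub>M lborel) (\<lambda>(x, y). indicat_real {y..} x * \<phi>' x * g y)"
  proof (rule Bochner_Integration.integrable_bound[OF prod])
    have "(\<lambda>p. (if snd p \<le> fst p then 1 else 0) * \<phi>' (fst p) * g (snd p)) \<in> borel_measurable (lborel \<Otimes>\<^sub>M lborel)"
      by measurable
    moreover have "(\<lambda>p. (if snd p \<le> fst p then 1 else 0) * \<phi>' (fst p) * g (snd p))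
       = (\<lambda>(x, y). indicat_real {y..} x * \<phi>' x * g y)"
      by (auto simp: fun_eq_iff)
    ultimately show "(\<lambda>(x, y). indicat_real {y..} x * \<phi>' x * g y) \<in> borel_measurable (lborel \<Otimes>\<^sub>M lborel)"
      by simp
  qed (auto split: split_indicator)
  from lborel_pair.Fubini_integral[OF this]
  have "(LINT x|lborel. (LINT y|lborel. indicat_real {y..} x * \<phi>' x * g y)) =
      (LINT y|lborel. (LINT x|lborel. indicat_real {y..} x * \<phi>' x * g y))" by simp
  also have "\<dots> = (LINT y|lborel. - (g y * \<phi> y))"
  proof (rule Bochner_Integration.integral_cong[OF refl])
    fix y
    have "(LINT x|lborel. indicat_real {y..} x * \<phi>' x) = - \<phi> y"
    proof (cases "y \<le> A")
      case True
      have "(LINT x|lborel. indicat_real {y..} x * \<phi>' x) = (LINT x|lborel. \<phi>' x * indicator {y..A} x)"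
        using z(2) by (intro Bochner_Integration.integral_cong) (auto split: split_indicator)
      also have "\<dots> = \<phi> A - \<phi> y"
        using True d c by (intro integral_FTC_Icc_real) (auto simp: continuous_on_eq_continuous_at)
      also have "\<phi> A = 0" by (rule z) simp
      finally show ?thesis by simp
    next
      case False
      have "indicat_real {y..} x * \<phi>' x = 0" for x
        using z(2)[of x] False by (auto split: split_indicator)
      then have "(LINT x|lborel. indicat_real {y..} x * \<phi>' x) = 0"
        by (simp only: integral_zero)
      then show ?thesis using z(1)[of y] False by simp
    qed
    then show "(LINT x|lborel. indicat_real {y..} x * \<phi>' x * g y) = - (g y * \<phi> y)" by simp
  qed
  also have "(\<lambda>x. LINT y|lborel. indicat_real {y..} x * \<phi>' x * g y) =
      (\<lambda>x. (LINT y|lborel. indicat_real {..x} y * g y) * \<phi>' x)"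
  proof
    fix x
    have "(LINT y|lborel. indicat_real {y..} x * \<phi>' x * g y) =
        (LINT y|lborel. (indicat_real {..x} y * g y) * \<phi>' x)"
      by (intro Bochner_Integration.integral_cong) (auto split: split_indicator)
    then show "(LINT y|lborel. indicat_real {y..} x * \<phi>' x * g y) =
        (LINT y|lborel. indicat_real {..x} y * g y) * \<phi>' x"
      by simp
  qed
  finally show ?thesis by simp
qed

text \<open>
  For a smooth step \<open>H\<close> from \<open>0\<close> to \<open>1\<close>, the function \<open>H (k (x - a)) - H (k (x - N))\<close> tends to the
  indicator of \<open>(a, N]\<close> as \<open>k\<close> grows. Subtracting
  \<open>N - a\<close> times a fixed bump of integral one makes it the derivative of a test function.
\<close>

lemma integral_against_test_derivatives:
  fixes u :: "real \<Rightarrow> real"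
  assumes u: "integrable lborel u" and N: "N \<ge> 0"
    and orth: "\<And>\<phi>. smooth \<phi> \<Longrightarrow> (\<And>x. \<bar>x\<bar> \<ge> N + 1 \<Longrightarrow> \<phi> x = 0) \<Longrightarrow> (LINT x|lborel. u x * deriv \<phi> x) = 0"
  obtains c where "\<And>a. -N \<le> a \<Longrightarrow> a \<le> N \<Longrightarrow> (LINT x|lborel. indicat_real {a<..N} x * u x) = (N - a) * c"
proof -
  obtain G where G: "smooth G" "\<And>x. x \<le> 0 \<Longrightarrow> G x = 0" "\<And>x. 0 \<le> deriv G x" "\<And>x. deriv G x \<le> 1"
    "\<And>x. x \<le> 0 \<Longrightarrow> deriv G x = 0" "\<And>x. x \<ge> 1 \<Longrightarrow> deriv G x = 1"
    using smooth_ramp_exists by blast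
  define H where "H = deriv G"
  have GH: "DERIV G x :> H x" for x unfolding H_def using G(1) by (rule smooth_DERIV)
  have H: "0 \<le> H x" "H x \<le> 1" "x \<le> 0 \<Longrightarrow> H x = 0" "x \<ge> 1 \<Longrightarrow> H x = 1" for x
    using G unfolding H_def by auto
  have [measurable]: "H \<in> borel_measurable borel"
    unfolding H_def using G(1) by (intro borel_measurable_continuous_onI smooth_continuous smooth_deriv)
  have [measurable]: "u \<in> borel_measurable borel" using u by auto
  have G1: "G x = G 1 + (x - 1)" if "x \<ge> 1" for x
  proof -
    have "DERIV (\<lambda>x. G x - x) y :> 0" if "1 \<le> y" for y
      using GH[of y] H(4)[OF that] by (auto intro!: derivative_eq_intros)
    then have "\<exists>c. \<forall>y\<in>{1..}. G y - y = c"
      by (intro has_field_derivative_zero_constant) (auto intro: has_field_derivative_at_within)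
    then obtain c where c: "\<And>y. y \<in> {1..} \<Longrightarrow> G y - y = c" by blast
    from c[of x] c[of 1] that show ?thesis by simp
  qed
  have uH: "integrable lborel (\<lambda>x. u x * H (s * x + t))" for s t
    by (rule Bochner_Integration.integrable_bound[OF u])
      (use H in \<open>auto intro!: AE_I2 mult_left_le simp: abs_mult\<close>)
  \<comment> \<open>\<open>c\<close> is the integral of \<open>u\<close> against the bump
    \<open>H (x + (N + 1)) - H (x + N)\<close>, which vanishes outside
    \<open>[-(N + 1), 1 - N]\<close>. The bump does not depend on \<open>a\<close>, so neither does
    \<open>c\<close>.\<close>
  define c where "c = (LINT x|lborel. u x * H (1 * x + (N + 1))) - (LINT x|lborel. u x * H (1 * x + N))"
  have "(LINT x|lborel. indicat_real {a<..N} x * u x) = (N - a) * c" if a: "-N \<le> a" "a \<le> N" for a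
  proof -
    \<comment> \<open>With \<open>Suc k\<close> the slope is at least one, so the step that starts
      at \<open>N\<close> is complete by \<open>N + 1\<close>, where the test function has to
      vanish.\<close>
    define h where "h k x = H (real (Suc k) * x + (- (real (Suc k) * a))) - H (real (Suc k) * x + (- (real (Suc k) * N)))" for k x
    have "(LINT x|lborel. u x * h k x) = (N - a) * c" for k
    proof -
      define q where "q = real (Suc k)"
      have q: "q \<ge> 1" by (simp add: q_def)
      \<comment> \<open>This is a primitive of \<open>h k\<close> minus \<open>N - a\<close> times
        the bump. All ramps are \<open>0\<close> far to the left; for \<open>x >= N + 1\<close> all
        are on their linear part, where the first pair contributes \<open>N - a\<close> and the
        second \<open>- (N - a)\<close>.\<close>
      define \<phi> where "\<phi> x = (1 / q * G (q * x + (- (q * a))) + (- (1 / q)) * G (q * x + (- (q * N)))) +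
        ((- (N - a)) * G (1 * x + (N + 1)) + (N - a) * G (1 * x + N))" for x
      have "smooth \<phi>" unfolding \<phi>_def by (intro smooth_add smooth_affine G)
      moreover have "\<phi> x = 0" if x: "\<bar>x\<bar> \<ge> N + 1" for x
      proof (cases "x \<le> 0")
        case True
        then have "x \<le> a" "x \<le> N" "x + (N + 1) \<le> 0" "x + N \<le> 0" using x a N by auto
        with q show ?thesis by (simp add: \<phi>_def G(2))
      next
        case False
        then have *: "x \<ge> N + 1" using x by auto
        have "q * 1 \<le> q * (x - a)" "q * 1 \<le> q * (x - N)"
          using q * a by (intro mult_left_mono; simp)+
        then have 1: "q * x + (- (q * a)) \<ge> 1" "q * x + (- (q * N)) \<ge> 1"
          using q by (auto simp: algebra_simps)
        have 2: "1 * x + (N + 1) \<ge> 1" "1 * x + N \<ge> 1" using * N by auto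
        show ?thesis
          using q unfolding \<phi>_def G1[OF 1(1)] G1[OF 1(2)] G1[OF 2(1)] G1[OF 2(2)]
          by (simp add: field_simps)
      qed
      ultimately have "(LINT x|lborel. u x * deriv \<phi> x) = 0" by (rule orth)
      moreover have "deriv \<phi> x = h k x - (N - a) * (H (1 * x + (N + 1)) - H (1 * x + N))" for x
        unfolding \<phi>_def h_def q_def[symmetric] using q
        by (intro DERIV_imp_deriv) (auto intro!: derivative_eq_intros DERIV_chain2[OF GH] simp: field_simps)
      moreover have "integrable lborel (\<lambda>x. u x * h k x)"
        unfolding h_def right_diff_distrib by (intro Bochner_Integration.integrable_diff uH)
      ultimately show ?thesis
        using uH[of 1 "N + 1"] uH[of 1 N]
        by (simp add: right_diff_distrib c_def mult.left_commute[of _ "N - a"] del: mult_1)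
    qed
    moreover have "(\<lambda>k. LINT x|lborel. u x * h k x) \<longlonglongrightarrow> (LINT x|lborel. indicat_real {a<..N} x * u x)"
    proof (rule integral_dominated_convergence[where w = "\<lambda>x. \<bar>u x\<bar>"])
      \<comment> \<open>At \<open>x = b\<close> the argument is \<open>0\<close>, where
        \<open>H\<close> vanishes, so the limit is the indicator of the open ray. Differences of
        these give half-open intervals.\<close>
      have lim: "(\<lambda>k. H (real (Suc k) * x + (- (real (Suc k) * b)))) \<longlonglongrightarrow> indicat_real {b<..} x" for b x
      proof (cases "x > b")
        case True
        obtain k0 where k0: "1 < real k0 * (x - b)"
          using True reals_Archimedean3[of "x - b"] by auto
        have "H (real (Suc k) * x + (- (real (Suc k) * b))) = 1" if "k \<ge> k0" for k
        proof (rule H(4))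
          have "real k0 * (x - b) \<le> real (Suc k) * (x - b)"
            using that True by (intro mult_right_mono) auto
          with k0 show "1 \<le> real (Suc k) * x + (- (real (Suc k) * b))" by (simp add: algebra_simps)
        qed
        then show ?thesis
          using True by (intro tendsto_eventually) (auto simp: eventually_sequentially)
      next
        case False
        then have "H (real (Suc k) * x + (- (real (Suc k) * b))) = 0" for k
          by (intro H(3)) (simp add: mult_left_mono del: of_nat_Suc)
        then show ?thesis using False by simp
      qed
      have "(\<lambda>k. u x * h k x) \<longlonglongrightarrow> u x * (indicat_real {a<..} x - indicat_real {N<..} x)" for x
        unfolding h_def by (intro tendsto_intros lim)
      moreover have "u x * (indicat_real {a<..} x - indicat_real {N<..} x) = indicat_real {a<..N} x * u x" for x
        using a by (auto split: split_indicator)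
      ultimately show "AE x in lborel. (\<lambda>k. u x * h k x) \<longlonglongrightarrow> indicat_real {a<..N} x * u x" by simp
      have "\<bar>h k x\<bar> \<le> 1" for k x
        using H(1,2)[of "real (Suc k) * x + (- (real (Suc k) * a))"]
          H(1,2)[of "real (Suc k) * x + (- (real (Suc k) * N))"] unfolding h_def by linarith
      then show "AE x in lborel. norm (u x * h k x) \<le> \<bar>u x\<bar>" for k
        by (auto simp: abs_mult intro!: mult_left_le)
    qed (use u in \<open>auto simp: h_def\<close>)
    ultimately show ?thesis by (simp add: LIMSEQ_const_iff)
  qed
  then show thesis by (rule that)
qed

lemma test_functionI:
  assumes "smooth \<phi>" and 0: "\<And>x. \<bar>x\<bar> \<ge> A \<Longrightarrow> \<phi> x = 0"
  shows "test_function \<phi>"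
proof -
  have "{x. \<phi> x \<noteq> 0} \<subseteq> {-A..A}"
    using 0 by (force simp: abs_le_iff not_le)
  then have "bounded {x. \<phi> x \<noteq> 0}"
    by (rule bounded_subset[OF bounded_closed_interval])
  then show ?thesis
    using assms(1) by (auto simp: test_function_def smooth_def compact_eq_bounded_closed)
qed

lemma integrable_indicator_Ioc:
  fixes a b :: real
  shows "integrable lborel (indicat_real {a<..b})"
proof (rule integrable_real_indicator)
  show "emeasure lborel {a<..b} < \<infinity>"
    by (rule emeasure_bounded_finite) (rule bounded_subset[OF bounded_closed_interval[of a b]], auto)
qed simp

lemma sq_integrable_indicator: "sq_integrable (indicat_real {a<..b})"
proof -
  have "(\<lambda>x. (indicat_real {a<..b} x)\<^sup>2) = indicat_real {a<..b}"
    by (auto split: split_indicator)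
  then show ?thesis by (simp add: sq_integrable_def integrable_indicator_Ioc)
qed

lemma sq_integrable_indicator_times:
  "sq_integrable g \<Longrightarrow> integrable lborel (\<lambda>x. indicat_real {a<..b} x * g x)"
  by (rule sq_integrable_mult[OF sq_integrable_indicator])

lemma sq_integrable_sq_on_interval:
  "sq_integrable g \<Longrightarrow> integrable lborel (\<lambda>x. indicat_real {a<..b} x * (g x)\<^sup>2)"
  using integrable_mult_indicator[of "{a<..b}" lborel "\<lambda>x. (g x)\<^sup>2"] by (simp add: sq_integrable_def)

text \<open>The integral of the squared deviation of \<open>g\<close> from its mean is nonnegative
  and equals \<open>J - I\<^sup>2 / (b - a)\<close>. The case \<open>a = b\<close>, where no mean
  exists, is trivial.\<close>

lemma Cauchy_Schwarz_interval:
  assumes g: "sq_integrable g" and "a \<le> b"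
  shows "(LINT t|lborel. indicat_real {a<..b} t * g t)\<^sup>2
    \<le> (b - a) * (LINT t|lborel. indicat_real {a<..b} t * (g t)\<^sup>2)"
proof (cases "a = b")
  case False
  define I where "I = (LINT t|lborel. indicat_real {a<..b} t * g t)"
  define J where "J = (LINT t|lborel. indicat_real {a<..b} t * (g t)\<^sup>2)"
  define s where "s = I / (b - a)" \<comment> \<open>the mean of \<open>g\<close>\<close>
  have "0 \<le> (LINT t|lborel. indicat_real {a<..b} t * (g t - s)\<^sup>2)"
    by (intro integral_nonneg_AE) auto
  also have "\<dots> = (LINT t|lborel. indicat_real {a<..b} t * (g t)\<^sup>2 - (2 * s) * (indicat_real {a<..b} t * g t)
      + s\<^sup>2 * indicat_real {a<..b} t)"
    by (intro Bochner_Integration.integral_cong) (auto simp: power2_diff algebra_simps)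
  also have "\<dots> = J - (2 * s) * I + s\<^sup>2 * (b - a)"
    using g \<open>a \<le> b\<close> unfolding I_def J_def
    by (simp add: sq_integrable_sq_on_interval sq_integrable_indicator_times integrable_indicator_Ioc)
  also have "\<dots> = J - I\<^sup>2 / (b - a)"
    using False by (simp add: s_def power_divide power2_eq_square[of "b - a"]) (simp add: power2_eq_square)
  finally show ?thesis
    using False \<open>a \<le> b\<close> unfolding I_def[symmetric] J_def[symmetric] by (simp add: field_simps)
qed simp

text \<open>Du Bois-Reymond's argument: \<open>u\<close>, which is \<open>f\<close> minus a
  primitive \<open>P\<close> of \<open>g\<close>, is orthogonal to derivatives of test functions,
  hence almost everywhere a constant \<open>c\<close>, and \<open>\<Phi>\<close> is
  \<open>P + c\<close>. The interval \<open>J\<close> exceeds the target by one on each side, as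
  \<open>integral_against_test_derivatives\<close> requires.\<close>

lemma weak_deriv_primitive:
  assumes f: "sq_integrable f" and g: "sq_integrable g" and N: "N \<ge> 0"
    and weak: "\<And>\<phi>. test_function \<phi> \<Longrightarrow>
      (LINT x|lborel. f x * deriv \<phi> x) = - (LINT x|lborel. g x * \<phi> x)"
  obtains \<Phi> where "AE x in lborel. -N < x \<and> x \<le> N \<longrightarrow> f x = \<Phi> x"
    and "\<And>x y. -N \<le> x \<Longrightarrow> x \<le> y \<Longrightarrow> y \<le> N \<Longrightarrow> \<Phi> y - \<Phi> x = (LINT t|lborel. indicat_real {x<..y} t * g t)"
proof -
  define J where "J = {-(N+1)<..N+1}"
  \<comment> \<open>A square-integrable \<open>g\<close> need not be integrable on the line; its
    restriction to the bounded set \<open>J\<close> is, which makes \<open>P\<close> well defined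
    and bounded.\<close>
  define g0 where "g0 x = indicat_real J x * g x" for x
  define P where "P x = (LINT y|lborel. indicat_real {..x} y * g0 y)" for x
  define u where "u x = indicat_real J x * f x - indicat_real J x * P x" for x
  have [measurable]: "J \<in> sets borel" by (simp add: J_def)
  have [measurable]: "f \<in> borel_measurable borel" "g \<in> borel_measurable borel" using f g by auto
  have g0: "integrable lborel g0"
    unfolding g0_def J_def using g by (rule sq_integrable_indicator_times)
  have g0_part: "integrable lborel (\<lambda>y. indicat_real {..x} y * g0 y)" for x
    using integrable_mult_indicator[OF _ g0, of "{..x}"] by simp
  have P_diff: "P y - P x = (LINT t|lborel. indicat_real {x<..y} t * g t)"
    if "-(N+1) \<le> x" "x \<le> y" "y \<le> N+1" for x y
  proof -
    have "P y - P x = (LINT t|lborel. indicat_real {..y} t * g0 t - indicat_real {..x} t * g0 t)"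
      unfolding P_def using g0_part by simp
    also have "\<dots> = (LINT t|lborel. indicat_real {x<..y} t * g t)"
      using that by (intro Bochner_Integration.integral_cong) (auto simp: g0_def J_def split: split_indicator)
    finally show ?thesis .
  qed
  have P_meas [measurable]: "P \<in> borel_measurable borel"
  proof -
    \<comment> \<open>The indicator of a set that varies with \<open>x\<close> becomes a condition
      on the pair, so the integral is measurable in its parameter.\<close>
    have "(\<lambda>x. LINT y|lborel. (if y \<le> x then 1 else 0) * g0 y) \<in> borel_measurable borel"
      unfolding g0_def by measurable
    also have "(\<lambda>x. LINT y|lborel. (if y \<le> x then 1 else 0) * g0 y) = P"
      unfolding P_def by (intro ext Bochner_Integration.integral_cong) auto
    finally show ?thesis .
  qed
  have P_bound: "\<bar>P x\<bar> \<le> (LINT y|lborel. \<bar>g0 y\<bar>)" for x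
  proof -
    have "\<bar>P x\<bar> \<le> (LINT y|lborel. \<bar>indicat_real {..x} y * g0 y\<bar>)"
      unfolding P_def by (rule integral_abs_bound)
    also have "\<dots> \<le> (LINT y|lborel. \<bar>g0 y\<bar>)"
      using g0 g0_part by (intro integral_mono integrable_abs) (auto split: split_indicator)
    finally show ?thesis .
  qed
  have fJ: "integrable lborel (\<lambda>x. indicat_real J x * f x)"
    unfolding J_def using f by (rule sq_integrable_indicator_times)
  have PJ: "integrable lborel (\<lambda>x. indicat_real J x * P x)"
  proof (rule Bochner_Integration.integrable_bound)
    show "integrable lborel (\<lambda>x. indicat_real J x * (LINT y|lborel. \<bar>g0 y\<bar>))"
      unfolding J_def by (intro integrable_mult_left integrable_indicator_Ioc)
    show "AE x in lborel. norm (indicat_real J x * P x) \<le> norm (indicat_real J x * (LINT y|lborel. \<bar>g0 y\<bar>))"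
      using P_bound by (intro AE_I2) (auto split: split_indicator intro: order_trans)
  qed simp
  have u: "integrable lborel u" unfolding u_def using fJ PJ by (rule Bochner_Integration.integrable_diff)
  have [measurable]: "u \<in> borel_measurable borel" using u by auto
  have "(LINT x|lborel. u x * deriv \<phi> x) = 0"
    if \<phi>: "smooth \<phi>" and z: "\<And>x. \<bar>x\<bar> \<ge> N + 1 \<Longrightarrow> \<phi> x = 0" for \<phi>
  proof -
    have z': "deriv \<phi> x = 0" if "\<bar>x\<bar> > N + 1" for x
    proof -
      have "open {x :: real. \<bar>x\<bar> > N + 1}"
        by (intro open_Collect_less continuous_intros)
      then have "\<forall>\<^sub>F y in nhds x. \<phi> y = 0"
        using that z by (intro eventually_mono[OF eventually_nhds_in_open[of "{x. \<bar>x\<bar> > N + 1}"]]) auto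
      then have "DERIV \<phi> x :> 0" by (subst DERIV_cong_ev[OF refl _ refl]) auto
      then show ?thesis by (rule DERIV_imp_deriv)
    qed
    have d\<phi>: "continuous_on UNIV (deriv \<phi>)"
      using \<phi> by (intro smooth_continuous smooth_deriv)
    have [measurable]: "deriv \<phi> \<in> borel_measurable borel"
      using d\<phi> by (rule borel_measurable_continuous_onI)
    have "compact {-(N+1)..N+1}" by simp
    then have "bounded (deriv \<phi> ` {-(N+1)..N+1})"
      using d\<phi> by (intro compact_imp_bounded compact_continuous_image) (auto intro: continuous_on_subset)
    then obtain M where M: "\<And>x. \<bar>x\<bar> \<le> N + 1 \<Longrightarrow> \<bar>deriv \<phi> x\<bar> \<le> M"
      by (force simp: bounded_iff abs_le_iff)
    have int: "integrable lborel (\<lambda>x. w x * deriv \<phi> x)"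
      if w: "integrable lborel w" for w
    proof (rule Bochner_Integration.integrable_bound[OF integrable_mult_left[OF w, of M]])
      show "AE x in lborel. norm (w x * deriv \<phi> x) \<le> norm (w x * M)"
      proof (rule AE_I2)
        fix x
        have "\<bar>deriv \<phi> x\<bar> \<le> \<bar>M\<bar>"
          using M[of x] z'[of x] by (cases "\<bar>x\<bar> \<le> N + 1") auto
        then show "norm (w x * deriv \<phi> x) \<le> norm (w x * M)"
          by (auto simp: abs_mult intro: mult_left_mono)
      qed
      show "(\<lambda>x. w x * deriv \<phi> x) \<in> borel_measurable lborel" using w by simp
    qed
    \<comment> \<open>Outside \<open>J\<close>, this is the one point that the strict inequality in
      \<open>z'\<close> misses.\<close>
    have AE_J: "AE x in lborel. x \<noteq> -(N+1)" by (rule AE_lborel_singleton)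
    have "(LINT x|lborel. u x * deriv \<phi> x) =
        (LINT x|lborel. (indicat_real J x * f x) * deriv \<phi> x) - (LINT x|lborel. (indicat_real J x * P x) * deriv \<phi> x)"
      unfolding u_def left_diff_distrib
      by (rule Bochner_Integration.integral_diff[OF int[OF fJ] int[OF PJ]])
    also have "(LINT x|lborel. (indicat_real J x * f x) * deriv \<phi> x) = (LINT x|lborel. f x * deriv \<phi> x)"
      by (intro integral_cong_AE; (measurable)?)
        (use AE_J in eventually_elim, use z' in \<open>force simp: J_def split: split_indicator\<close>)
    also have "(LINT x|lborel. (indicat_real J x * P x) * deriv \<phi> x) = (LINT x|lborel. P x * deriv \<phi> x)"
      by (intro integral_cong_AE; (measurable)?)
        (use AE_J in eventually_elim, use z' in \<open>force simp: J_def split: split_indicator\<close>)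
    also have "\<dots> = - (LINT x|lborel. g0 x * \<phi> x)"
      unfolding P_def
      by (rule integral_primitive_by_parts[OF g0 smooth_DERIV[OF \<phi>] d\<phi>, of "N + 1"]) (use z z' in auto)
    also have "(LINT x|lborel. g0 x * \<phi> x) = (LINT x|lborel. g x * \<phi> x)"
      using z by (intro Bochner_Integration.integral_cong) (auto simp: g0_def J_def split: split_indicator)
    also have "(LINT x|lborel. f x * deriv \<phi> x) = - (LINT x|lborel. g x * \<phi> x)"
      by (rule weak, rule test_functionI[OF \<phi> z])
    finally show ?thesis by simp
  qed
  then obtain c where c: "\<And>a. -N \<le> a \<Longrightarrow> a \<le> N \<Longrightarrow> (LINT x|lborel. indicat_real {a<..N} x * u x) = (N - a) * c"
    using integral_against_test_derivatives[OF u N] by blast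
  define w where "w x = indicat_real {-N<..N} x * (u x - c)" for x
  have ind: "integrable lborel (\<lambda>x. indicat_real {a<..N} x * u x)" for a
    using integrable_mult_indicator[OF _ u, of "{a<..N}"] by simp
  have w_int: "integrable lborel w"
    unfolding w_def right_diff_distrib by (intro Bochner_Integration.integrable_diff ind integrable_mult_left integrable_indicator_Ioc)
  have "AE x in lborel. w x = 0"
  proof (rule AE_eq_0_of_integral_greaterThan[OF w_int])
    fix a
    \<comment> \<open>Clamping \<open>a\<close> to \<open>[-N, N]\<close> does not change the
      integral of \<open>w\<close> over the ray and brings it into the range covered by
      \<open>c\<close>.\<close>
    define a' where "a' = max (-N) (min a N)"
    have "(LINT y|lborel. indicat_real {a<..} y * w y) =
        (LINT y|lborel. indicat_real {a'<..N} y * u y - indicat_real {a'<..N} y * c)"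
      using N by (intro Bochner_Integration.integral_cong) (auto simp: w_def a'_def split: split_indicator)
    also have "\<dots> = (N - a') * c - (N - a') * c"
      using c[of a'] ind[of a'] N by (simp add: a'_def integrable_indicator_Ioc)
    finally show "(LINT y|lborel. indicat_real {a<..} y * w y) = 0" by simp
  qed
  then have "AE x in lborel. -N < x \<and> x \<le> N \<longrightarrow> f x = P x + c"
    by eventually_elim (use N in \<open>auto simp: w_def u_def J_def split: split_indicator_asm\<close>)
  then show thesis
    by (rule that) (use P_diff in auto)
qed

section \<open>The upper bound\<close>

lemma L2_rel_refl: "sq_integrable f \<Longrightarrow> L2_rel f f"
  by (simp add: L2_rel_def)

lemma L2_cases:
  obtains f where "sq_integrable f" "v = abs_L2 f"
proof (rule that)
  show "sq_integrable (rep_L2 v)"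
    using Quotient_rep_reflp[OF Quotient_L2] by (simp add: L2_rel_def)
  show "v = abs_L2 (rep_L2 v)"
    by (rule Quotient_abs_rep[OF Quotient_L2, symmetric])
qed

lemma sq_integrable_sum:
  "(\<And>i. i \<in> I \<Longrightarrow> sq_integrable (f i)) \<Longrightarrow> sq_integrable (\<lambda>x. \<Sum>i\<in>I. c i * f i x)"
  by (induction I rule: infinite_finite_induct)
    (auto simp: sq_integrable_zero intro!: sq_integrable_add sq_integrable_scale)

lemma abs_L2_sum:
  assumes "\<And>i. i \<in> I \<Longrightarrow> sq_integrable (f i)"
  shows "(\<Sum>i\<in>I. c i *\<^sub>R abs_L2 (f i)) = abs_L2 (\<lambda>x. \<Sum>i\<in>I. c i * f i x)"
  using assms
proof (induction I rule: infinite_finite_induct)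
  case (insert i I)
  then have "sq_integrable (f i)" "sq_integrable (\<lambda>x. \<Sum>i\<in>I. c i * f i x)"
    by (auto intro: sq_integrable_sum)
  with insert show ?case
    by (simp add: plus_L2.abs_eq scaleR_L2.abs_eq L2_rel_refl sq_integrable_scale)
qed (simp_all add: zero_L2_def)

lemma norm_abs_L2:
  assumes "sq_integrable f"
  shows "(norm (abs_L2 f))\<^sup>2 = (LINT x|lborel. (f x)\<^sup>2)"
  unfolding power2_norm_eq_inner inner_L2.abs_eq[OF L2_rel_refl[OF assms] L2_rel_refl[OF assms]]
  by (simp add: power2_eq_square)

lemma abs_L2_diff:
  assumes "sq_integrable f" "sq_integrable g"
  shows "abs_L2 f - abs_L2 g = abs_L2 (\<lambda>x. f x - g x)"
  using assms sq_integrable_scale[OF assms(2), of "-1"]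
  by (simp add: minus_L2_def plus_L2.abs_eq uminus_L2.abs_eq L2_rel_refl)

section \<open>Half-open cells of equal length, which tile an interval without overlap\<close>

definition cell :: "real \<Rightarrow> real \<Rightarrow> nat \<Rightarrow> real set" where
  "cell a h j = {a + real j * h <.. a + real (Suc j) * h}"

lemma cell_sets [measurable]: "cell a h j \<in> sets borel"
  by (simp add: cell_def)

lemma cell_exists:
  assumes "a < x" "x \<le> a + real n * h"
  obtains j where "j < n" "x \<in> cell a h j"
proof -
  have "\<exists>j<n. x \<in> cell a h j"
    using assms(2)
  proof (induction n)
    case (Suc n)
    then show ?case
      by (cases "x \<le> a + real n * h") (auto simp: cell_def less_Suc_eq simp del: of_nat_Suc)
  qed (use assms(1) in simp)
  with that show thesis by blast
qed

lemma cell_unique: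
  assumes "h > 0" "x \<in> cell a h i" "x \<in> cell a h j"
  shows "i = j"
proof -
  have "j \<le> i" if "x \<in> cell a h i" "x \<in> cell a h j" for i j
  proof (rule ccontr)
    assume "\<not> j \<le> i"
    then have "real (Suc i) * h \<le> real j * h"
      using assms(1) by (intro mult_right_mono) auto
    with that show False by (simp add: cell_def)
  qed
  from this[OF assms(2,3)] this[OF assms(3,2)] show ?thesis by simp
qed

lemma step_function_eq:
  assumes "h > 0" "x \<in> cell a h j" "j < n"
  shows "(\<Sum>i<n. s i * indicat_real (cell a h i) x) = s j"
proof -
  have "(\<Sum>i<n. s i * indicat_real (cell a h i) x) = (\<Sum>i<n. if i = j then s j else 0)"
  proof (rule sum.cong)
    fix i
    show "s i * indicat_real (cell a h i) x = (if i = j then s j else 0)"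
      using assms(2) cell_unique[OF assms(1), of x a i j] by (cases "x \<in> cell a h i") auto
  qed simp
  with assms(3) show ?thesis by simp
qed

lemma step_function_eq_0:
  assumes "h > 0" "\<not> (a < x \<and> x \<le> a + real n * h)"
  shows "(\<Sum>i<n. s i * indicat_real (cell a h i) x) = 0"
proof (rule sum.neutral, rule ballI)
  fix i assume "i \<in> {..<n}"
  then have "0 \<le> real i * h" "real (Suc i) * h \<le> real n * h"
    using assms(1) by (auto intro!: mult_right_mono simp del: of_nat_Suc)
  with assms(2) have "x \<notin> cell a h i" by (auto simp: cell_def)
  then show "s i * indicat_real (cell a h i) x = 0" by simp
qed

text \<open>The cells are disjoint, so their indicators sum to at most one at each point.\<close>

lemma sum_cell_energy_le:
  assumes "h > 0" "sq_integrable g"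
  shows "(\<Sum>j<n. LINT t|lborel. indicat_real (cell a h j) t * (g t)\<^sup>2) \<le> (LINT t|lborel. (g t)\<^sup>2)"
proof -
  have "(\<Sum>j<n. LINT t|lborel. indicat_real (cell a h j) t * (g t)\<^sup>2) =
      (LINT t|lborel. (\<Sum>j<n. indicat_real (cell a h j) t * (g t)\<^sup>2))"
    unfolding cell_def using assms(2)
    by (intro Bochner_Integration.integral_sum[symmetric] sq_integrable_sq_on_interval)
  also have "\<dots> \<le> (LINT t|lborel. (g t)\<^sup>2)"
  proof (rule integral_mono)
    fix t
    have "(\<Sum>j<n. 1 * indicat_real (cell a h j) t) \<le> 1"
      using step_function_eq[OF assms(1), of t a _ n "\<lambda>_. 1"]
        step_function_eq_0[OF assms(1), of a t n "\<lambda>_. 1"] cell_exists[of a t n h]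
      by (cases "a < t \<and> t \<le> a + real n * h") (simp, metis order_refl, simp)
    then show "(\<Sum>j<n. indicat_real (cell a h j) t * (g t)\<^sup>2) \<le> (g t)\<^sup>2"
      using mult_right_mono[of "\<Sum>j<n. indicat_real (cell a h j) t" 1 "(g t)\<^sup>2"]
      by (simp add: sum_distrib_right)
    show "integrable lborel (\<lambda>t. \<Sum>j<n. indicat_real (cell a h j) t * (g t)\<^sup>2)"
      unfolding cell_def using assms(2)
      by (intro Bochner_Integration.integrable_sum sq_integrable_sq_on_interval)
  qed (use assms(2) in \<open>simp add: sq_integrable_def\<close>)
  finally show ?thesis .
qed

text \<open>On cell \<open>j\<close> the squared error is at most \<open>h * m j\<close>, where
  \<open>m j\<close> is the energy of the weak derivative there; integrating over length
  \<open>h\<close> and summing gives at most \<open>h\<^sup>2\<close>, since the weight of the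
  derivative is at least one. Outside \<open>(-R, R]\<close> the weight of \<open>f\<close> is at
  least \<open>(1 + R) ^ 3\<close>.\<close>

lemma K_step_approximation:
  fixes R h :: real and n :: nat
  assumes "v \<in> K" and R: "R > 0" and n: "n \<ge> 1" and h: "h = 2 * R / real n"
  obtains s where "(norm (v - (\<Sum>j<n. s j *\<^sub>R abs_L2 (indicat_real (cell (-R) h j)))))\<^sup>2
    \<le> 1 / (1 + R) ^ 3 + h\<^sup>2"
proof -
  obtain v' where weak: "has_weak_deriv v v'"
    and wt: "weighted_sq_integral (\<lambda>u. (1 + \<bar>u\<bar>) ^ 3) v + weighted_sq_integral (\<lambda>u. (1 + \<bar>u\<bar>) ^ 7) v' \<le> 1"
    using assms(1) unfolding K_def by blast
  obtain f where f: "sq_integrable f" "v = abs_L2 f" by (rule L2_cases)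
  obtain g where g: "sq_integrable g" "v' = abs_L2 g" by (rule L2_cases)
  have [measurable]: "f \<in> borel_measurable borel" "g \<in> borel_measurable borel" using f g by auto
  have h0: "h > 0" and hn: "real n * h = 2 * R" using R n h by auto
  have wf: "(\<integral>\<^sup>+u. ennreal ((f u)\<^sup>2 * (1 + \<bar>u\<bar>) ^ 3) \<partial>lborel) \<le> 1"
    and wg: "(\<integral>\<^sup>+u. ennreal ((g u)\<^sup>2 * (1 + \<bar>u\<bar>) ^ 7) \<partial>lborel) \<le> 1"
  proof -
    have *: "(\<integral>\<^sup>+u. ennreal ((f u)\<^sup>2 * (1 + \<bar>u\<bar>) ^ 3) \<partial>lborel)
        + (\<integral>\<^sup>+u. ennreal ((g u)\<^sup>2 * (1 + \<bar>u\<bar>) ^ 7) \<partial>lborel) \<le> 1"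
      using wt f g by (simp add: weighted_sq_integral.abs_eq L2_rel_refl)
    show "(\<integral>\<^sup>+u. ennreal ((f u)\<^sup>2 * (1 + \<bar>u\<bar>) ^ 3) \<partial>lborel) \<le> 1"
      by (rule order_trans[OF add_increasing2[OF zero_le order_refl] *])
    show "(\<integral>\<^sup>+u. ennreal ((g u)\<^sup>2 * (1 + \<bar>u\<bar>) ^ 7) \<partial>lborel) \<le> 1"
      by (rule order_trans[OF add_increasing[OF zero_le order_refl] *])
  qed
  have g_le_1: "(LINT t|lborel. (g t)\<^sup>2) \<le> 1"
  proof -
    have "ennreal (LINT t|lborel. (g t)\<^sup>2) = (\<integral>\<^sup>+u. ennreal ((g u)\<^sup>2) \<partial>lborel)"
      using g(1) by (intro nn_integral_eq_integral[symmetric]) (auto simp: sq_integrable_def)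
    also have "\<dots> \<le> (\<integral>\<^sup>+u. ennreal ((g u)\<^sup>2 * (1 + \<bar>u\<bar>) ^ 7) \<partial>lborel)"
      by (intro nn_integral_mono ennreal_leI) (simp add: mult_le_cancel_left1)
    also note wg
    finally show ?thesis by simp
  qed
  obtain \<Phi> where \<Phi>: "AE x in lborel. -R < x \<and> x \<le> R \<longrightarrow> f x = \<Phi> x"
    and \<Phi>_diff: "\<And>x y. -R \<le> x \<Longrightarrow> x \<le> y \<Longrightarrow> y \<le> R \<Longrightarrow> \<Phi> y - \<Phi> x = (LINT t|lborel. indicat_real {x<..y} t * g t)"
  proof (rule weak_deriv_primitive[OF f(1) g(1), of R])
    show "(LINT x|lborel. f x * deriv \<phi> x) = - (LINT x|lborel. g x * \<phi> x)" if "test_function \<phi>" for \<phi>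
      using weak that f g by (simp add: has_weak_deriv.abs_eq L2_rel_refl)
  qed (use R in auto)
  define m where "m j = (LINT t|lborel. indicat_real (cell (-R) h j) t * (g t)\<^sup>2)" for j
  have m0: "m j \<ge> 0" for j unfolding m_def by (intro integral_nonneg_AE) auto
  \<comment> \<open>\<open>f\<close> is determined only almost everywhere, so the value at the left
    end of a cell is taken from \<open>\<Phi>\<close>.\<close>
  define s where "s j = \<Phi> (-R + real j * h)" for j
  define S where "S x = (\<Sum>j<n. s j * indicat_real (cell (-R) h j) x)" for x
  have sqc: "sq_integrable (indicat_real (cell (-R) h j))" for j
    unfolding cell_def by (rule sq_integrable_indicator)
  have sqS: "sq_integrable S"
    unfolding S_def by (intro sq_integrable_sum sqc)
  have near: "(\<Phi> x - s j)\<^sup>2 \<le> h * m j" if x: "x \<in> cell (-R) h j" and j: "j < n" for x j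
  proof -
    define a where "a = -R + real j * h"
    have a: "-R \<le> a" "a \<le> x" "x - a \<le> h" "x \<le> R"
    proof -
      have "real (Suc j) * h \<le> real n * h"
        using j h0 by (intro mult_right_mono) auto
      then show "-R \<le> a" "a \<le> x" "x - a \<le> h" "x \<le> R"
        using x h0 hn by (auto simp: cell_def a_def algebra_simps)
    qed
    have "(\<Phi> x - s j)\<^sup>2 = (LINT t|lborel. indicat_real {a<..x} t * g t)\<^sup>2"
      using \<Phi>_diff[of a x] a by (simp add: s_def a_def)
    also have "\<dots> \<le> (x - a) * (LINT t|lborel. indicat_real {a<..x} t * (g t)\<^sup>2)"
      using g(1) a by (intro Cauchy_Schwarz_interval)
    also have "\<dots> \<le> h * m j"
    proof (intro mult_mono)
      show "(LINT t|lborel. indicat_real {a<..x} t * (g t)\<^sup>2) \<le> m j"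
        unfolding m_def using g(1) x
        by (intro integral_mono) (auto simp: cell_def a_def sq_integrable_sq_on_interval split: split_indicator)
    qed (use a h0 in \<open>auto intro!: integral_nonneg_AE\<close>)
    finally show ?thesis .
  qed
  \<comment> \<open>The sum controls the error inside the interval and the weighted term the error
    outside; both are nonnegative, so one inequality covers the two cases.\<close>
  have pw: "AE x in lborel. (f x - S x)\<^sup>2 \<le>
      (f x)\<^sup>2 * (1 + \<bar>x\<bar>) ^ 3 / (1 + R) ^ 3 + (\<Sum>j<n. (h * m j) * indicat_real (cell (-R) h j) x)"
    using \<Phi>
  proof eventually_elim
    case (elim x)
    show ?case
    proof (cases "-R < x \<and> x \<le> -R + real n * h")
      case True
      then obtain j where j: "j < n" "x \<in> cell (-R) h j" using cell_exists[of "-R" x n h] by blast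
      have "(f x - S x)\<^sup>2 \<le> h * m j"
        using elim True hn near[OF j(2,1)] by (simp add: S_def step_function_eq[OF h0 j(2,1)])
      moreover have "0 \<le> (f x)\<^sup>2 * (1 + \<bar>x\<bar>) ^ 3 / (1 + R) ^ 3" using R by simp
      ultimately show ?thesis by (simp add: step_function_eq[OF h0 j(2,1)])
    next
      case False
      then have "(1 + R) ^ 3 \<le> (1 + \<bar>x\<bar>) ^ 3" using hn R by (intro power_mono) auto
      then have "(f x)\<^sup>2 * (1 + R) ^ 3 \<le> (f x)\<^sup>2 * (1 + \<bar>x\<bar>) ^ 3" by (intro mult_left_mono) auto
      then show ?thesis
        using R by (simp add: S_def step_function_eq_0[OF h0 False] pos_le_divide_eq)
    qed
  qed
  \<comment> \<open>The estimate runs through nonnegative integrals, the form in which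
    \<open>wf\<close> is given and in which linearity asks for no integrability.\<close>
  have "ennreal ((norm (v - abs_L2 S))\<^sup>2) = ennreal (LINT x|lborel. (f x - S x)\<^sup>2)"
    using f sqS sq_integrable_add[OF f(1) sq_integrable_scale[OF sqS, of "-1"]]
    by (simp add: abs_L2_diff norm_abs_L2)
  also have "\<dots> = (\<integral>\<^sup>+x. ennreal ((f x - S x)\<^sup>2) \<partial>lborel)"
    using sq_integrable_add[OF f(1) sq_integrable_scale[OF sqS, of "-1"]]
    by (intro nn_integral_eq_integral[symmetric]) (auto simp: sq_integrable_def)
  also have "\<dots> \<le> (\<integral>\<^sup>+x. ennreal (1 / (1 + R) ^ 3) * ennreal ((f x)\<^sup>2 * (1 + \<bar>x\<bar>) ^ 3)
      + (\<Sum>j<n. ennreal (h * m j) * indicator (cell (-R) h j) x) \<partial>lborel)"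
  proof (rule nn_integral_mono_AE, use pw in eventually_elim)
    case (elim x)
    have "(\<Sum>j<n. ennreal (h * m j) * indicator (cell (-R) h j) x) =
        ennreal (\<Sum>j<n. (h * m j) * indicat_real (cell (-R) h j) x)"
      using h0 m0 by (subst sum_ennreal[symmetric])
        (auto simp: ennreal_mult' ennreal_indicator intro!: sum.cong mult_nonneg_nonneg split: split_indicator)
    moreover have "ennreal (1 / (1 + R) ^ 3) * ennreal ((f x)\<^sup>2 * (1 + \<bar>x\<bar>) ^ 3) =
        ennreal ((f x)\<^sup>2 * (1 + \<bar>x\<bar>) ^ 3 / (1 + R) ^ 3)"
      using R by (subst ennreal_mult[symmetric]) auto
    ultimately show ?case
      using elim R h0 m0 by (simp add: ennreal_plus[symmetric] sum_nonneg ennreal_leI del: ennreal_plus)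
  qed
  also have "\<dots> = ennreal (1 / (1 + R) ^ 3) * (\<integral>\<^sup>+x. ennreal ((f x)\<^sup>2 * (1 + \<bar>x\<bar>) ^ 3) \<partial>lborel)
      + (\<Sum>j<n. ennreal (h * m j) * emeasure lborel (cell (-R) h j))"
  proof (subst nn_integral_add)
    have "(\<integral>\<^sup>+x. (\<Sum>j<n. ennreal (h * m j) * indicator (cell (-R) h j) x) \<partial>lborel) =
        (\<Sum>j<n. ennreal (h * m j) * emeasure lborel (cell (-R) h j))"
      by (subst nn_integral_sum) (simp_all only: nn_integral_cmult_indicator cell_sets sets_lborel, measurable)
    then show "(\<integral>\<^sup>+x. ennreal (1 / (1 + R) ^ 3) * ennreal ((f x)\<^sup>2 * (1 + \<bar>x\<bar>) ^ 3) \<partial>lborel)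
        + (\<integral>\<^sup>+x. (\<Sum>j<n. ennreal (h * m j) * indicator (cell (-R) h j) x) \<partial>lborel) =
      ennreal (1 / (1 + R) ^ 3) * (\<integral>\<^sup>+x. ennreal ((f x)\<^sup>2 * (1 + \<bar>x\<bar>) ^ 3) \<partial>lborel)
        + (\<Sum>j<n. ennreal (h * m j) * emeasure lborel (cell (-R) h j))"
      by (simp only: nn_integral_cmult) (subst nn_integral_cmult, measurable)
  qed measurable
  also have "\<dots> \<le> ennreal (1 / (1 + R) ^ 3) * 1 + (\<Sum>j<n. ennreal (h * m j * h))"
  proof (intro add_mono mult_left_mono wf sum_mono)
    fix j
    have "emeasure lborel (cell (-R) h j) = ennreal h"
      using h0 by (simp add: cell_def algebra_simps)
    then show "ennreal (h * m j) * emeasure lborel (cell (-R) h j) \<le> ennreal (h * m j * h)"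
      using h0 m0 by (simp add: ennreal_mult)
  qed simp
  also have "\<dots> = ennreal (1 / (1 + R) ^ 3 + h\<^sup>2 * (\<Sum>j<n. m j))"
    using R h0 m0
    by (simp add: sum_ennreal ennreal_plus[symmetric] sum_nonneg sum_distrib_left power2_eq_square mult_ac
        del: ennreal_plus)
  also have "\<dots> \<le> ennreal (1 / (1 + R) ^ 3 + h\<^sup>2)"
  proof (rule ennreal_leI)
    have "(\<Sum>j<n. m j) \<le> 1"
      using sum_cell_energy_le[OF h0 g(1)] g_le_1 unfolding m_def by (rule order_trans)
    then show "1 / (1 + R) ^ 3 + h\<^sup>2 * (\<Sum>j<n. m j) \<le> 1 / (1 + R) ^ 3 + h\<^sup>2"
      by (simp add: mult_left_le)
  qed
  finally have "(norm (v - abs_L2 S))\<^sup>2 \<le> 1 / (1 + R) ^ 3 + h\<^sup>2"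
    using R by (subst (asm) ennreal_le_iff) auto
  then show thesis
    using that[of s] sqc unfolding S_def by (simp add: abs_L2_sum)
qed

text \<open>For this \<open>R\<close> the tail term is at most \<open>n powr (- 3 / 5)\<close>, the
  square of the claimed rate, while \<open>h\<^sup>2\<close> is \<open>4 * n powr (- 8 / 5)\<close>.
  Their sum is at most \<open>5 * n powr (- 3 / 5)\<close>, within the factor
  \<open>9 = 3\<^sup>2\<close>.\<close>

lemma kolmogorov_width_K_upper:
  assumes n: "n \<ge> 1"
  shows "kolmogorov_width n K \<le> ennreal (3 / real n powr (3 / 10))"
proof -
  define R where "R = real n powr (1 / 5)"
  define h where "h = 2 * R / real n"
  have R: "R > 0" using n by (simp add: R_def)
  define B where "B = (\<lambda>j. abs_L2 (indicat_real (cell (-R) h j))) ` {..<n}"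
  have B: "finite B" "card B \<le> n"
    unfolding B_def using card_image_le[of "{..<n}"] by auto
  have "dim (span B) \<le> n"
    using dim_le_card[OF order_refl B(1)] B(2) by linarith
  with B(1) have L: "span B \<in> {L. subspace L \<and> (\<exists>B. finite B \<and> span B = L) \<and> dim L \<le> n}"
    by blast
  have bound: "1 / (1 + R) ^ 3 + h\<^sup>2 \<le> (3 / real n powr (3 / 10))\<^sup>2"
  proof -
    have n35: "(real n powr (3 / 10))\<^sup>2 = real n powr (3 / 5)"
      using n by (simp add: power2_eq_square powr_add[symmetric])
    have R3: "R ^ 3 = real n powr (3 / 5)"
      using n by (simp add: R_def powr_power)
    have "1 / (1 + R) ^ 3 \<le> 1 / R ^ 3"
      using R by (intro divide_left_mono power_mono) auto
    moreover have "h\<^sup>2 = 4 * real n powr (- 8 / 5)"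
    proof -
      have "h = 2 * real n powr (1 / 5 - 1)"
        using n unfolding powr_diff by (simp add: h_def R_def)
      then show ?thesis
        using n by (simp add: power_mult_distrib powr_power)
    qed
    moreover have "real n powr (- 8 / 5) \<le> real n powr (- 3 / 5)"
      using n by (intro powr_mono) auto
    moreover have "real n powr (- 3 / 5) = 1 / real n powr (3 / 5)"
      using powr_minus_divide[of "real n" "3 / 5"] by simp
    moreover have "0 \<le> 1 / real n powr (3 / 5)" by simp
    moreover have "(3 / real n powr (3 / 10))\<^sup>2 = 9 * (1 / real n powr (3 / 5))"
      unfolding power_divide n35 by simp
    ultimately show ?thesis
      unfolding R3 by linarith
  qed
  have "(SUP f\<in>K. INF g\<in>span B. ennreal (norm (f - g))) \<le> ennreal (3 / real n powr (3 / 10))"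
  proof (rule SUP_least)
    fix v assume "v \<in> K"
    then obtain s where s: "(norm (v - (\<Sum>j<n. s j *\<^sub>R abs_L2 (indicat_real (cell (-R) h j)))))\<^sup>2
        \<le> 1 / (1 + R) ^ 3 + h\<^sup>2"
      using K_step_approximation[OF _ R n h_def] by blast
    define w where "w = (\<Sum>j<n. s j *\<^sub>R abs_L2 (indicat_real (cell (-R) h j)))"
    have "w \<in> span B"
      unfolding w_def B_def by (intro span_sum span_scale span_base) auto
    moreover have "norm (v - w) \<le> 3 / real n powr (3 / 10)"
      by (rule power2_le_imp_le) (use order_trans[OF s bound] in \<open>auto simp: w_def\<close>)
    ultimately show "(INF g\<in>span B. ennreal (norm (v - g))) \<le> ennreal (3 / real n powr (3 / 10))"
      by (meson INF_lower2 ennreal_leI)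
  qed
  with L show ?thesis
    unfolding kolmogorov_width_def by (rule INF_lower2)
qed

section \<open>The lower bound\<close>

text \<open>A dimension count: \<open>T\<close> maps the span of \<open>n + 1\<close> independent
  vectors into \<open>span B\<close>, of dimension at most \<open>n\<close>, so it annihilates a
  nonzero vector.\<close>

lemma exists_orthogonal_combination:
  fixes e :: "nat \<Rightarrow> 'a::real_inner"
  assumes orth: "\<And>i j. i \<noteq> j \<Longrightarrow> inner (e i) (e j) = 0" and nz: "\<And>i. e i \<noteq> 0"
    and B: "finite B" "card B \<le> n"
  obtains c where "(\<Sum>i\<le>n. c i *\<^sub>R e i) \<noteq> 0" "\<And>b. b \<in> B \<Longrightarrow> inner (\<Sum>i\<le>n. c i *\<^sub>R e i) b = 0"
proof -
  define E where "E = e ` {..n}"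
  \<comment> \<open>\<open>inner v (T v)\<close> is the sum of the \<open>(inner v b)\<^sup>2\<close>, so the kernel of \<open>T\<close> is orthogonal to \<open>B\<close>.\<close>
  define T where "T v = (\<Sum>b\<in>B. inner v b *\<^sub>R b)" for v
  have lin: "linear T"
    unfolding T_def
    by (rule linearI) (simp_all add: inner_add_left scaleR_add_left sum.distrib scaleR_sum_right)
  have inj_e: "inj_on e {..n}"
  proof (rule inj_onI, rule ccontr)
    fix i j assume "e i = e j" "i \<noteq> j"
    then show False using orth[of i j] nz[of j] by simp
  qed
  have "pairwise orthogonal E"
    unfolding E_def by (rule pairwise_imageI) (auto intro!: orth simp: orthogonal_def)
  moreover have "0 \<notin> E"
  proof
    assume "0 \<in> E"
    then obtain i where "0 = e i" by (auto simp: E_def)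
    then show False using nz[of i] by simp
  qed
  ultimately have ind: "independent E" by (rule pairwise_orthogonal_independent)
  have "\<not> inj_on T (span E)"
  proof
    assume inj: "inj_on T (span E)"
    then have "inj_on T E" by (rule inj_on_subset) (rule span_superset)
    have "independent (T ` E)"
      using ind inj by (rule linear_independent_injective_image[OF lin])
    moreover have "T v \<in> span B" for v
      unfolding T_def by (intro span_sum span_scale span_base)
    then have "T ` E \<subseteq> span B" by blast
    ultimately have "card (T ` E) \<le> card B"
      using independent_span_bound[OF B(1)] by blast
    moreover have "card (T ` E) = Suc n"
      using card_image[OF \<open>inj_on T E\<close>] card_image[OF inj_e] by (simp add: E_def)
    ultimately show False using B(2) by simp
  qed
  then obtain v where v: "v \<in> span E" "T v = 0" "v \<noteq> 0"
    using linear_injective_on_subspace_0[OF lin subspace_span] by blast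
  have "inner v b = 0" if "b \<in> B" for b
  proof -
    have "(\<Sum>b\<in>B. (inner v b)\<^sup>2) = inner v (T v)"
      by (simp add: T_def inner_sum_right power2_eq_square)
    also have "\<dots> = 0" using v by simp
    finally have "\<forall>b\<in>B. (inner v b)\<^sup>2 = 0"
      by (subst (asm) sum_nonneg_eq_0_iff) (use B(1) in auto)
    then show ?thesis using that by simp
  qed
  moreover obtain u where "v = (\<Sum>w\<in>E. u w *\<^sub>R w)"
    using v(1) unfolding E_def by (auto simp: span_finite)
  then have "v = (\<Sum>i\<le>n. u (e i) *\<^sub>R e i)"
    unfolding E_def by (simp add: sum.reindex[OF inj_e])
  ultimately show thesis using that[of "\<lambda>i. u (e i)"] v(3) by simp
qed

text \<open>A vector \<open>v\<close> of the sphere that is orthogonal to \<open>L\<close> has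
  distance at least \<open>r\<close> from it, because the squared norm of \<open>v - g\<close> is
  \<open>r\<^sup>2\<close> plus that of \<open>g\<close>.\<close>

lemma kolmogorov_width_ge:
  fixes e :: "nat \<Rightarrow> 'a::real_inner"
  assumes orth: "\<And>i j. i \<noteq> j \<Longrightarrow> inner (e i) (e j) = 0" and nz: "\<And>i. e i \<noteq> 0"
    and r: "r > 0" and sphere: "\<And>c. norm (\<Sum>i\<le>n. c i *\<^sub>R e i) = r \<Longrightarrow> (\<Sum>i\<le>n. c i *\<^sub>R e i) \<in> C"
  shows "ennreal r \<le> kolmogorov_width n C"
  unfolding kolmogorov_width_def
proof (rule INF_greatest)
  fix L :: "'a set" assume "L \<in> {L. subspace L \<and> (\<exists>B. finite B \<and> span B = L) \<and> dim L \<le> n}"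
  then obtain B0 where L: "finite B0" "span B0 = L" "dim L \<le> n" by blast
  \<comment> \<open>\<open>B0\<close> may have more than \<open>n\<close> elements; a basis of
    \<open>L\<close> has exactly \<open>dim L\<close>.\<close>
  obtain B where B: "B \<subseteq> L" "independent B" "L \<subseteq> span B" "card B = dim L"
    using basis_exists by blast
  have "finite B" using independent_span_bound[OF L(1) B(2)] B(1) L(2) by simp
  obtain c where c: "(\<Sum>i\<le>n. c i *\<^sub>R e i) \<noteq> 0"
    "\<And>b. b \<in> B \<Longrightarrow> inner (\<Sum>i\<le>n. c i *\<^sub>R e i) b = 0"
  proof (rule exists_orthogonal_combination[where e = e and B = B and n = n])
    show "card B \<le> n" using B(4) L(3) by simp
  qed (use orth nz \<open>finite B\<close> in auto)
  define t where "t = r / norm (\<Sum>i\<le>n. c i *\<^sub>R e i)"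
  define v where "v = (\<Sum>i\<le>n. (t * c i) *\<^sub>R e i)"
  have v_eq: "v = t *\<^sub>R (\<Sum>i\<le>n. c i *\<^sub>R e i)"
    by (simp add: v_def scaleR_sum_right)
  have nv: "norm v = r" using c(1) r by (simp add: v_eq t_def)
  have orth_L: "inner v g = 0" if "g \<in> L" for g
  proof -
    have "orthogonal v g"
      by (rule orthogonal_to_span[of _ B]) (use that B c(2) in \<open>auto simp: orthogonal_def v_eq\<close>)
    then show ?thesis by (simp add: orthogonal_def)
  qed
  have "ennreal r \<le> (INF g\<in>L. ennreal (norm (v - g)))"
  proof (rule INF_greatest, rule ennreal_leI)
    fix g assume "g \<in> L"
    then have "(norm (v - g))\<^sup>2 = (norm v)\<^sup>2 + (norm g)\<^sup>2"
      using orth_L[of g] unfolding power2_norm_eq_inner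
      by (simp add: inner_diff_left inner_diff_right inner_commute[of g v])
    then have "r\<^sup>2 \<le> (norm (v - g))\<^sup>2" by (simp add: nv)
    then show "r \<le> norm (v - g)" by (rule power2_le_imp_le) simp
  qed
  moreover have "v \<in> C"
    using sphere[of "\<lambda>i. t * c i"] nv by (simp add: v_def)
  ultimately show "ennreal r \<le> (SUP f\<in>C. INF g\<in>L. ennreal (norm (f - g)))"
    by (rule SUP_upper2[rotated])
qed

section \<open>Parabolic bumps and their integrals\<close>

lemma has_bochner_integral_FTC_Ioc:
  fixes F p :: "real \<Rightarrow> real"
  assumes "a \<le> b" "\<And>x. DERIV F x :> p x" "\<And>x. isCont p x"
  shows "has_bochner_integral lborel (\<lambda>x. indicat_real {a<..b} x * p x) (F b - F a)"
proof -
  have [measurable]: "p \<in> borel_measurable borel"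
    using assms(3) by (intro borel_measurable_continuous_onI) (simp add: continuous_on_eq_continuous_at)
  have "AE x in lborel. x \<noteq> a" by (rule AE_lborel_singleton)
  then have "AE x in lborel. p x * indicator {a..b} x = indicat_real {a<..b} x * p x"
    by eventually_elim (auto split: split_indicator)
  moreover have "has_bochner_integral lborel (\<lambda>x. p x * indicator {a..b} x) (F b - F a)"
    by (rule has_bochner_integral_FTC_Icc_real) (use assms in auto)
  ultimately show ?thesis
    by (subst has_bochner_integral_cong_AE[symmetric]) auto
qed

lemma integrable_Ioc_continuous:
  fixes p :: "real \<Rightarrow> real"
  assumes "\<And>x. isCont p x"
  shows "integrable lborel (\<lambda>x. indicat_real {a<..b} x * p x)"
proof -
  have "integrable lborel (\<lambda>x. indicator {a..b} x *\<^sub>R p x)"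
    using assms by (intro borel_integrable_compact) (auto simp: continuous_at_imp_continuous_on)
  then have "integrable lborel (\<lambda>x. indicat_real {a<..b} x *\<^sub>R (indicator {a..b} x *\<^sub>R p x))"
    by (rule integrable_mult_indicator[rotated]) simp
  also have "(\<lambda>x. indicat_real {a<..b} x *\<^sub>R (indicator {a..b} x *\<^sub>R p x)) =
      (\<lambda>x. indicat_real {a<..b} x * p x)"
    by (auto split: split_indicator)
  finally show ?thesis .
qed

lemma sq_integrable_Ioc_continuous:
  fixes p :: "real \<Rightarrow> real"
  assumes "\<And>x. isCont p x"
  shows "sq_integrable (\<lambda>x. indicat_real {a<..b} x * p x)"
proof -
  have "(\<lambda>x. (indicat_real {a<..b} x * p x)\<^sup>2) = (\<lambda>x. indicat_real {a<..b} x * (p x)\<^sup>2)"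
    by (auto split: split_indicator)
  moreover have "integrable lborel (\<lambda>x. indicat_real {a<..b} x * (p x)\<^sup>2)"
    using assms by (intro integrable_Ioc_continuous continuous_intros)
  moreover have "integrable lborel (\<lambda>x. indicat_real {a<..b} x * p x)"
    using assms by (rule integrable_Ioc_continuous)
  ultimately show ?thesis by (auto simp: sq_integrable_def)
qed

text \<open>The parabola vanishes at both ends, so its extension by zero is continuous and its weak
  derivative has no point masses.\<close>

definition bump :: "real \<Rightarrow> real \<Rightarrow> real \<Rightarrow> real" where
  "bump a b x = indicat_real {a<..b} x * ((x - a) * (b - x))"

definition bump_deriv :: "real \<Rightarrow> real \<Rightarrow> real \<Rightarrow> real" where
  "bump_deriv a b x = indicat_real {a<..b} x * (a + b - 2 * x)"

lemma sq_integrable_bump: "sq_integrable (bump a b)" "sq_integrable (bump_deriv a b)"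
  unfolding bump_def[abs_def] bump_deriv_def[abs_def]
  by (intro sq_integrable_Ioc_continuous continuous_intros)+

lemma integral_bump_sq:
  assumes "a \<le> b"
  shows "(LINT x|lborel. (bump a b x)\<^sup>2) = (b - a) ^ 5 / 30"
proof -
  \<comment> \<open>Substituting \<open>b - x = (b - a) - (x - a)\<close> and expanding the square
    in powers of \<open>x - a\<close> allows termwise integration.\<close>
  define F where "F x = (b - a)\<^sup>2 * (x - a) ^ 3 / 3 - (b - a) * (x - a) ^ 4 / 2 + (x - a) ^ 5 / 5" for x
  have "DERIV F x :> ((x - a) * (b - x))\<^sup>2" for x
  proof -
    have "DERIV F x :> (b - a)\<^sup>2 * (x - a)\<^sup>2 - 2 * (b - a) * (x - a) ^ 3 + (x - a) ^ 4"
      unfolding F_def by (auto intro!: derivative_eq_intros simp: field_simps)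
    also have "(b - a)\<^sup>2 * (x - a)\<^sup>2 - 2 * (b - a) * (x - a) ^ 3 + (x - a) ^ 4 = ((x - a) * (b - x))\<^sup>2"
      by algebra
    finally show ?thesis .
  qed
  then have "has_bochner_integral lborel (\<lambda>x. indicat_real {a<..b} x * ((x - a) * (b - x))\<^sup>2) (F b - F a)"
    by (intro has_bochner_integral_FTC_Ioc assms continuous_intros)
  moreover have "F b - F a = (b - a) ^ 5 / 30"
    by (simp add: F_def field_simps power2_eq_square eval_nat_numeral)
  moreover have "(\<lambda>x. indicat_real {a<..b} x * ((x - a) * (b - x))\<^sup>2) = (\<lambda>x. (bump a b x)\<^sup>2)"
    by (auto simp: bump_def split: split_indicator)
  ultimately show ?thesis by (simp add: has_bochner_integral_iff)
qed

lemma integral_bump_deriv_sq: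
  assumes "a \<le> b"
  shows "(LINT x|lborel. (bump_deriv a b x)\<^sup>2) = (b - a) ^ 3 / 3"
proof -
  define F where "F x = - ((a + b - 2 * x) ^ 3 / 6)" for x
  have "DERIV F x :> (a + b - 2 * x)\<^sup>2" for x
    unfolding F_def by (auto intro!: derivative_eq_intros)
  then have "has_bochner_integral lborel (\<lambda>x. indicat_real {a<..b} x * (a + b - 2 * x)\<^sup>2) (F b - F a)"
    by (intro has_bochner_integral_FTC_Ioc assms continuous_intros)
  moreover have "F b - F a = (b - a) ^ 3 / 3"
    by (simp add: F_def field_simps eval_nat_numeral)
  moreover have "(\<lambda>x. indicat_real {a<..b} x * (a + b - 2 * x)\<^sup>2) = (\<lambda>x. (bump_deriv a b x)\<^sup>2)"
    by (auto simp: bump_deriv_def split: split_indicator)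
  ultimately show ?thesis by (simp add: has_bochner_integral_iff)
qed

text \<open>The parabola times \<open>\<phi>\<close> vanishes at \<open>a\<close> and
  \<open>b\<close> whatever \<open>\<phi>\<close> does there, so its derivative integrates to zero
  over the interval.\<close>

lemma bump_weak_deriv:
  assumes \<phi>: "test_function \<phi>" and "a \<le> b"
  shows "integrable lborel (\<lambda>x. bump a b x * deriv \<phi> x)" "integrable lborel (\<lambda>x. bump_deriv a b x * \<phi> x)"
    and "(LINT x|lborel. bump a b x * deriv \<phi> x) = - (LINT x|lborel. bump_deriv a b x * \<phi> x)"
proof -
  have diff: "(deriv ^^ k) \<phi> differentiable at x" for k x
    using \<phi> by (simp add: test_function_def differentiable_on_def)
  have D: "DERIV \<phi> x :> deriv \<phi> x" for x
    using diff[of 0 x] by (simp add: DERIV_deriv_iff_real_differentiable)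
  have cont [continuous_intros]: "isCont \<phi> x" "isCont (deriv \<phi>) x" for x
    using diff[of 0 x] diff[of 1 x] by (auto intro: differentiable_imp_continuous_within)
  have int1: "integrable lborel (\<lambda>x. indicat_real {a<..b} x * (((x - a) * (b - x)) * deriv \<phi> x))"
    by (intro integrable_Ioc_continuous continuous_intros cont)
  have int2: "integrable lborel (\<lambda>x. indicat_real {a<..b} x * ((a + b - 2 * x) * \<phi> x))"
    by (intro integrable_Ioc_continuous continuous_intros cont)
  show i1: "integrable lborel (\<lambda>x. bump a b x * deriv \<phi> x)" and i2: "integrable lborel (\<lambda>x. bump_deriv a b x * \<phi> x)"
    using int1 int2 by (simp_all add: bump_def bump_deriv_def mult.assoc)
  define F where "F x = ((x - a) * (b - x)) * \<phi> x" for x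
  have "DERIV F x :> ((x - a) * (b - x)) * deriv \<phi> x + (a + b - 2 * x) * \<phi> x" for x
    unfolding F_def by (auto intro!: derivative_eq_intros D simp: algebra_simps)
  then have "has_bochner_integral lborel
      (\<lambda>x. indicat_real {a<..b} x * (((x - a) * (b - x)) * deriv \<phi> x + (a + b - 2 * x) * \<phi> x)) (F b - F a)"
    by (intro has_bochner_integral_FTC_Ioc assms continuous_intros cont)
  then have "(LINT x|lborel. bump a b x * deriv \<phi> x + bump_deriv a b x * \<phi> x) = 0"
    by (simp add: has_bochner_integral_iff F_def bump_def bump_deriv_def algebra_simps)
  then show "(LINT x|lborel. bump a b x * deriv \<phi> x) = - (LINT x|lborel. bump_deriv a b x * \<phi> x)"
    using i1 i2 by simp
qed

text \<open>The weight is at most \<open>2 ^ p\<close> on the support.\<close>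

lemma weighted_sq_integral_le:
  assumes f: "sq_integrable f" and supp: "\<And>x. x \<notin> {0..1} \<Longrightarrow> f x = 0"
  shows "weighted_sq_integral (\<lambda>u. (1 + \<bar>u\<bar>) ^ p) (abs_L2 f) \<le> ennreal (2 ^ p * (norm (abs_L2 f))\<^sup>2)"
proof -
  have "weighted_sq_integral (\<lambda>u. (1 + \<bar>u\<bar>) ^ p) (abs_L2 f) = (\<integral>\<^sup>+u. ennreal ((f u)\<^sup>2 * (1 + \<bar>u\<bar>) ^ p) \<partial>lborel)"
    using f by (simp add: weighted_sq_integral.abs_eq L2_rel_refl)
  also have "\<dots> \<le> (\<integral>\<^sup>+u. ennreal (2 ^ p * (f u)\<^sup>2) \<partial>lborel)"
  proof (intro nn_integral_mono ennreal_leI)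
    fix u
    show "(f u)\<^sup>2 * (1 + \<bar>u\<bar>) ^ p \<le> 2 ^ p * (f u)\<^sup>2"
    proof (cases "u \<in> {0..1}")
      case True
      then have "(1 + \<bar>u\<bar>) ^ p \<le> 2 ^ p" by (intro power_mono) auto
      then show ?thesis by (subst mult.commute) (rule mult_right_mono, simp_all)
    qed (simp add: supp)
  qed
  also have "\<dots> = ennreal (2 ^ p * (LINT u|lborel. (f u)\<^sup>2))"
    using f by (subst nn_integral_eq_integral) (auto simp: sq_integrable_def)
  finally show ?thesis using f by (simp add: norm_abs_L2)
qed

lemma kolmogorov_width_K_lower:
  assumes n: "n \<ge> 1"
  shows "ennreal (1 / 80 / real n) \<le> kolmogorov_width n K"
proof -
  define h where "h = 1 / real (Suc n)"
  have h: "h > 0" by (simp add: h_def)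
  \<comment> \<open>The family is indexed by all naturals, as \<open>kolmogorov_width_ge\<close>
    expects; the cells with \<open>i <= n\<close> fill \<open>(0, 1]\<close>.\<close>
  define q where "q i = bump (real i * h) (real (Suc i) * h)" for i
  define q' where "q' i = bump_deriv (real i * h) (real (Suc i) * h)" for i
  have width: "real (Suc i) * h - real i * h = h" for i by (simp add: algebra_simps)
  have ends: "real i * h \<le> real (Suc i) * h" for i using h by (intro mult_right_mono) auto
  have sq: "sq_integrable (q i)" "sq_integrable (q' i)" for i
    unfolding q_def q'_def by (rule sq_integrable_bump)+
  have norm_q: "(norm (abs_L2 (q i)))\<^sup>2 = h ^ 5 / 30" for i
    using sq(1) by (simp add: norm_abs_L2 q_def integral_bump_sq[OF ends] width del: of_nat_Suc)
  \<comment> \<open>Written as a multiple of \<open>norm_q\<close>, the ratio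
    \<open>10 / h\<^sup>2\<close> is the same for all bumps; since both families are orthogonal, it
    carries over to every linear combination.\<close>
  have norm_q': "(norm (abs_L2 (q' i)))\<^sup>2 = 10 / h\<^sup>2 * (h ^ 5 / 30)" for i
  proof -
    have "(norm (abs_L2 (q' i)))\<^sup>2 = h ^ 3 / 3"
      using sq(2) by (simp add: norm_abs_L2 q'_def integral_bump_deriv_sq[OF ends] width del: of_nat_Suc)
    also have "\<dots> = 10 / h\<^sup>2 * (h ^ 5 / 30)"
      using h by (simp add: field_simps eval_nat_numeral)
    finally show ?thesis .
  qed
  have zero: "q i x = 0" "q' i x = 0" if "x \<notin> cell 0 h i" for i x
    using that by (auto simp: q_def q'_def bump_def bump_deriv_def cell_def)
  have disj: "q i x * q j x = 0" "q' i x * q' j x = 0" if "i \<noteq> j" for i j x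
    using that zero[of x i] zero[of x j] cell_unique[OF h, of x 0 i j] by auto
  have orth: "inner (abs_L2 (q i)) (abs_L2 (q j)) = 0" "inner (abs_L2 (q' i)) (abs_L2 (q' j)) = 0"
    if "i \<noteq> j" for i j
    by (simp_all only: inner_L2.abs_eq[OF L2_rel_refl L2_rel_refl] sq disj[OF that] integral_zero)
  have nz: "abs_L2 (q i) \<noteq> 0" for i
    using norm_q[of i] h by auto
  show ?thesis
  proof (rule kolmogorov_width_ge[where e = "\<lambda>i. abs_L2 (q i)"])
    fix c :: "nat \<Rightarrow> real"
    define F where "F x = (\<Sum>i\<le>n. c i * q i x)" for x
    define F' where "F' x = (\<Sum>i\<le>n. c i * q' i x)" for x
    have sqF: "sq_integrable F" "sq_integrable F'"
      unfolding F_def F'_def using sq by (auto intro: sq_integrable_sum)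
    have F_eq: "(\<Sum>i\<le>n. c i *\<^sub>R abs_L2 (q i)) = abs_L2 F" "(\<Sum>i\<le>n. c i *\<^sub>R abs_L2 (q' i)) = abs_L2 F'"
      unfolding F_def F'_def using sq by (simp_all add: abs_L2_sum)
    assume "norm (\<Sum>i\<le>n. c i *\<^sub>R abs_L2 (q i)) = 1 / 80 / real n"
    then have nF: "(norm (abs_L2 F))\<^sup>2 = (1 / 80 / real n)\<^sup>2" by (simp add: F_eq)
    have "(norm (\<Sum>i\<le>n. c i *\<^sub>R abs_L2 (q i)))\<^sup>2 = (\<Sum>i\<le>n. (norm (c i *\<^sub>R abs_L2 (q i)))\<^sup>2)"
      using orth by (intro norm_sum_Pythagorean) (auto simp: pairwise_def orthogonal_def)
    then have 1: "(norm (abs_L2 F))\<^sup>2 = (\<Sum>i\<le>n. (c i)\<^sup>2 * (h ^ 5 / 30))"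
      by (simp add: F_eq power_mult_distrib norm_q)
    have "(norm (\<Sum>i\<le>n. c i *\<^sub>R abs_L2 (q' i)))\<^sup>2 = (\<Sum>i\<le>n. (norm (c i *\<^sub>R abs_L2 (q' i)))\<^sup>2)"
      using orth by (intro norm_sum_Pythagorean) (auto simp: pairwise_def orthogonal_def)
    then have "(norm (abs_L2 F'))\<^sup>2 = (\<Sum>i\<le>n. (c i)\<^sup>2 * (10 / h\<^sup>2 * (h ^ 5 / 30)))"
      by (simp only: F_eq norm_scaleR power_mult_distrib norm_q' power2_abs)
    also have "\<dots> = 10 / h\<^sup>2 * (norm (abs_L2 F))\<^sup>2"
      unfolding 1 sum_distrib_left by (intro sum.cong) (auto simp: mult_ac)
    finally have nF': "(norm (abs_L2 F'))\<^sup>2 = 10 / h\<^sup>2 * (1 / 80 / real n)\<^sup>2" by (simp only: nF)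
    have supp: "F x = 0" "F' x = 0" if "x \<notin> {0..1}" for x
    proof -
      have "x \<notin> cell 0 h i" if "i \<le> n" for i
      proof -
        have "real (Suc i) * h \<le> real (Suc n) * h" "0 \<le> real i * h"
          using that h by (auto intro!: mult_right_mono simp del: of_nat_Suc)
        moreover have "real (Suc n) * h = 1" by (simp add: h_def)
        ultimately show ?thesis using \<open>x \<notin> {0..1}\<close> by (auto simp: cell_def simp del: of_nat_Suc)
      qed
      then show "F x = 0" "F' x = 0"
        unfolding F_def F'_def by (auto intro!: sum.neutral simp: zero)
    qed
    have weak: "has_weak_deriv (abs_L2 F) (abs_L2 F')"
      unfolding has_weak_deriv.abs_eq[OF L2_rel_refl[OF sqF(1)] L2_rel_refl[OF sqF(2)]]
    proof (intro allI impI)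
      fix \<phi> assume \<phi>: "test_function \<phi>"
      note b = bump_weak_deriv[OF \<phi> ends, folded q_def q'_def]
      have "(LINT x|lborel. F x * deriv \<phi> x) = (\<Sum>i\<le>n. c i * (LINT x|lborel. q i x * deriv \<phi> x))"
        unfolding F_def sum_distrib_right mult.assoc
        using b(1) by (simp add: Bochner_Integration.integral_sum)
      also have "\<dots> = - (\<Sum>i\<le>n. c i * (LINT x|lborel. q' i x * \<phi> x))"
        by (simp add: b(3) sum_negf)
      also have "(\<Sum>i\<le>n. c i * (LINT x|lborel. q' i x * \<phi> x)) = (LINT x|lborel. F' x * \<phi> x)"
        unfolding F'_def sum_distrib_right mult.assoc
        using b(2) by (simp add: Bochner_Integration.integral_sum)
      finally show "(LINT x|lborel. F x * deriv \<phi> x) = - (LINT x|lborel. F' x * \<phi> x)" .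
    qed
    have "weighted_sq_integral (\<lambda>u. (1 + \<bar>u\<bar>) ^ 3) (abs_L2 F) + weighted_sq_integral (\<lambda>u. (1 + \<bar>u\<bar>) ^ 7) (abs_L2 F')
        \<le> ennreal (2 ^ 3 * (norm (abs_L2 F))\<^sup>2) + ennreal (2 ^ 7 * (norm (abs_L2 F'))\<^sup>2)"
      using supp sqF by (intro add_mono weighted_sq_integral_le)
    also have "\<dots> = ennreal (2 ^ 3 * (norm (abs_L2 F))\<^sup>2 + 2 ^ 7 * (norm (abs_L2 F'))\<^sup>2)"
      by (intro ennreal_plus[symmetric]) auto
    also have "\<dots> \<le> ennreal 1"
    proof (rule ennreal_leI)
      \<comment> \<open>Source of \<open>1 / 80\<close>: as \<open>n + 1 <= 2 * n\<close>, the
        derivative term is at most \<open>2 ^ 7 * 10 * 4 / 80\<^sup>2 = 4 / 5\<close>, and the other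
        term is at most \<open>8 / 80\<^sup>2\<close>.\<close>
      have n1: "real n \<ge> 1" using n by simp
      have "(real (Suc n) / real n)\<^sup>2 \<le> 2\<^sup>2"
        using n1 by (intro power_mono) (auto simp: field_simps)
      moreover have "(1 / real n)\<^sup>2 \<le> 1\<^sup>2"
        using n1 by (intro power_mono) auto
      moreover have "10 / h\<^sup>2 * (1 / 80 / real n)\<^sup>2 = 10 / 6400 * (real (Suc n) / real n)\<^sup>2"
        by (simp add: h_def power_divide)
      moreover have "(1 / 80 / real n)\<^sup>2 = 1 / 6400 * (1 / real n)\<^sup>2"
        by (simp add: power_divide)
      ultimately show "2 ^ 3 * (norm (abs_L2 F))\<^sup>2 + 2 ^ 7 * (norm (abs_L2 F'))\<^sup>2 \<le> 1"
        unfolding nF nF' by (simp del: of_nat_Suc)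
    qed
    finally show "(\<Sum>i\<le>n. c i *\<^sub>R abs_L2 (q i)) \<in> K"
      using weak unfolding F_eq K_def W21_def by auto
  qed (use n orth(1) nz in auto)
qed

theorem lemma3p2:
  shows "\<exists>C1 C2 :: real. C1 > 0 \<and> C2 > 0 \<and>
    (\<forall>n::nat. n \<ge> 1 \<longrightarrow>
       ennreal (C1 / real n) \<le> kolmogorov_width n K \<and>
       kolmogorov_width n K \<le> ennreal (C2 / real n powr (3 / 10)))"
proof (intro exI conjI allI impI)
  fix n :: nat assume "n \<ge> 1"
  then show "ennreal (1 / 80 / real n) \<le> kolmogorov_width n K"
    "kolmogorov_width n K \<le> ennreal (3 / real n powr (3 / 10))"
    by (rule kolmogorov_width_K_lower, rule kolmogorov_width_K_upper)
qed simp_all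

end
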